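(* Let $P$ be a left Ore semigroup (with unit element) whose constructible right ideals are independent. Then there exists a homomorphism of C*-algebras $$\Delta_P: C^*_r(P)\to C^*_r(P)\otimes_{\min}C^*_r(P)\quad\text{determined by}\quad V_p\mapsto V_p\otimes V_p\ \ (p\in P).$$
   Context: Semigroups are discrete and have a unit element. A left (resp. right) ideal of $P$ is a subset $X$ with $px\in X$ (resp. $xp\in X$) for all $x\in X$, $p\in P$. $P$ is left Ore if it is cancellative and any two non-empty left ideals intersect. For $X\subseteq P$, $p\in P$ put $pX=\{px:x\in X\}$ and $p^{-1}X=\{q\in P: pq\in X\}$. The family $\mathcal J$ of constructible right ideals is the smallest family of right ideals of $P$ which contains $\emptyset$ and $P$, is closed under $X\mapsto pX$ and $X\mapsto p^{-1}X$ for all $p\in P$, and is closed under finite intersections. The constructible right ideals are independent if for all $X,X_1,\dots,X_n\in\mathcal J$ with $X=\bigcup_{j=1}^nX_j$ we have $X=X_j$ for some $j$. $C^*_r(P)$ is the C*-subalgebra of $\mathcal L(\ell^2(P))$ generated by the isometries $V_p$, $p\in P$, with $V_p\varepsilon_x=\varepsilon_{px}$ on the canonical orthonormal basis. *)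

theory Defs
  imports "HOL-Analysis.Analysis"
begin

section \<open>The Hilbert space of square-summable functions\<close>

typedef 'a ell2 = "{f :: 'a \<Rightarrow> complex. (\<lambda>x. (cmod (f x))\<^sup>2) summable_on UNIV}"
  by (rule exI[of _ "\<lambda>_. 0"]) simp

setup_lifting type_definition_ell2

lemma ell2_summable: "(\<lambda>x. (cmod (Rep_ell2 f x))\<^sup>2) summable_on A"
  using Rep_ell2[of f] summable_on_subset_banach[of _ UNIV A] by auto

lemma ell2_summable_product:
  "(\<lambda>x. cmod (Rep_ell2 f x) * cmod (Rep_ell2 g x)) summable_on A"
proof -
  have "(\<lambda>x. cmod (Rep_ell2 f x * Rep_ell2 g x)) summable_on A"
    by (rule Infinite_Sum.abs_summable_product)
       (use ell2_summable[of f A] ell2_summable[of g A] in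
         \<open>simp_all add: norm_mult power2_eq_square\<close>)
  then show ?thesis by (simp add: norm_mult)
qed

lemma square_summable_add:
  fixes f g :: "'a \<Rightarrow> complex"
  assumes "(\<lambda>x. (cmod (f x))\<^sup>2) summable_on A" "(\<lambda>x. (cmod (g x))\<^sup>2) summable_on A"
  shows "(\<lambda>x. (cmod (f x + g x))\<^sup>2) summable_on A"
proof (rule summable_on_comparison_test)
  show "(\<lambda>x. 2 * (cmod (f x))\<^sup>2 + 2 * (cmod (g x))\<^sup>2) summable_on A"
    by (intro summable_on_add summable_on_cmult_right assms)
  show "(cmod (f x + g x))\<^sup>2 \<le> 2 * (cmod (f x))\<^sup>2 + 2 * (cmod (g x))\<^sup>2" for x
  proof -
    have "(cmod (f x + g x))\<^sup>2 \<le> (cmod (f x) + cmod (g x))\<^sup>2"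
      by (intro power_mono norm_triangle_ineq) simp
    also have "\<dots> \<le> 2 * (cmod (f x))\<^sup>2 + 2 * (cmod (g x))\<^sup>2"
      using sum_squares_bound[of "cmod (f x)" "cmod (g x)"] by (simp add: power2_sum)
    finally show ?thesis .
  qed
qed simp_all

lemma square_summable_cmult:
  fixes f :: "'a \<Rightarrow> complex"
  assumes "(\<lambda>x. (cmod (f x))\<^sup>2) summable_on A"
  shows "(\<lambda>x. (cmod (c * f x))\<^sup>2) summable_on A"
  using summable_on_cmult_right[OF assms, of "(cmod c)\<^sup>2"]
  by (simp add: norm_mult power_mult_distrib)

lemma square_summable_diff:
  fixes f g :: "'a \<Rightarrow> complex"
  assumes "(\<lambda>x. (cmod (f x))\<^sup>2) summable_on A" "(\<lambda>x. (cmod (g x))\<^sup>2) summable_on A"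
  shows "(\<lambda>x. (cmod (f x - g x))\<^sup>2) summable_on A"
  using square_summable_add[of f A "\<lambda>x. - g x"] assms by simp

lemma ell2_inner_summable: "(\<lambda>x. inner (Rep_ell2 f x) (Rep_ell2 g x)) summable_on A"
proof (rule abs_summable_summable, rule summable_on_comparison_test)
  show "(\<lambda>x. cmod (Rep_ell2 f x) * cmod (Rep_ell2 g x)) summable_on A"
    by (rule ell2_summable_product)
  show "norm (inner (Rep_ell2 f x) (Rep_ell2 g x)) \<le> cmod (Rep_ell2 f x) * cmod (Rep_ell2 g x)" for x
    using Cauchy_Schwarz_ineq2[of "Rep_ell2 f x" "Rep_ell2 g x"] by simp
qed simp

instantiation ell2 :: (type) real_vector
begin
lift_definition zero_ell2 :: "'a ell2" is "\<lambda>_. 0" by simp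
lift_definition plus_ell2 :: "'a ell2 \<Rightarrow> 'a ell2 \<Rightarrow> 'a ell2" is "\<lambda>f g x. f x + g x"
  by (simp add: square_summable_add)
lift_definition uminus_ell2 :: "'a ell2 \<Rightarrow> 'a ell2" is "\<lambda>f x. - f x" by simp
lift_definition minus_ell2 :: "'a ell2 \<Rightarrow> 'a ell2 \<Rightarrow> 'a ell2" is "\<lambda>f g x. f x - g x"
  by (rule square_summable_diff)
lift_definition scaleR_ell2 :: "real \<Rightarrow> 'a ell2 \<Rightarrow> 'a ell2" is "\<lambda>r f x. r *\<^sub>R f x"
  by (simp add: scaleR_conv_of_real square_summable_cmult)
instance
proof
  fix a b c :: "'a ell2" and r s :: real
  show "a + b + c = a + (b + c)" by transfer (simp add: add.assoc)
  show "a + b = b + a" by transfer (simp add: add.commute)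
  show "0 + a = a" by transfer simp
  show "- a + a = 0" by transfer simp
  show "a - b = a + - b" by transfer simp
  show "r *\<^sub>R (a + b) = r *\<^sub>R a + r *\<^sub>R b" by transfer (simp add: scaleR_add_right)
  show "(r + s) *\<^sub>R a = r *\<^sub>R a + s *\<^sub>R a" by transfer (simp add: scaleR_add_left)
  show "r *\<^sub>R s *\<^sub>R a = (r * s) *\<^sub>R a" by transfer simp
  show "1 *\<^sub>R a = a" by transfer simp
qed
end

instantiation ell2 :: (type) real_inner
begin
definition inner_ell2 :: "'a ell2 \<Rightarrow> 'a ell2 \<Rightarrow> real" where
  "inner_ell2 f g = (\<Sum>\<^sub>\<infinity>x. inner (Rep_ell2 f x) (Rep_ell2 g x))"
definition norm_ell2 :: "'a ell2 \<Rightarrow> real" where "norm_ell2 f = sqrt (inner f f)"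
definition dist_ell2 :: "'a ell2 \<Rightarrow> 'a ell2 \<Rightarrow> real" where "dist_ell2 f g = norm (f - g)"
definition sgn_ell2 :: "'a ell2 \<Rightarrow> 'a ell2" where "sgn_ell2 f = f /\<^sub>R norm f"
definition uniformity_ell2 :: "('a ell2 \<times> 'a ell2) filter" where
  "uniformity_ell2 = (INF e\<in>{0 <..}. principal {(f, g). dist f g < e})"
definition open_ell2 :: "'a ell2 set \<Rightarrow> bool" where
  "open_ell2 U \<longleftrightarrow> (\<forall>f\<in>U. \<forall>\<^sub>F (f', g) in uniformity. f' = f \<longrightarrow> g \<in> U)"
instance
proof
  fix f g h :: "'a ell2" and r :: real
  show "inner f g = inner g f" by (simp add: inner_ell2_def inner_commute)
  show "inner (f + g) h = inner f h + inner g h"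
    unfolding inner_ell2_def plus_ell2.rep_eq inner_add_left
    by (intro infsum_add ell2_inner_summable)
  show "inner (r *\<^sub>R f) g = r * inner f g"
    unfolding inner_ell2_def scaleR_ell2.rep_eq inner_scaleR_left
    by (rule infsum_cmult_right) (rule ell2_inner_summable)
  show "0 \<le> inner f f" unfolding inner_ell2_def by (rule infsum_nonneg) simp
  show "inner f f = 0 \<longleftrightarrow> f = 0"
  proof
    assume "inner f f = 0"
    then have "inner (Rep_ell2 f x) (Rep_ell2 f x) = 0" for x
      unfolding inner_ell2_def
      by (intro nonneg_infsum_le_0D[of "\<lambda>x. inner (Rep_ell2 f x) (Rep_ell2 f x)" UNIV])
         (auto simp: ell2_inner_summable)
    then show "f = 0" by (simp add: Rep_ell2_inject[symmetric] zero_ell2.rep_eq fun_eq_iff)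
  qed (simp add: inner_ell2_def zero_ell2.rep_eq)
qed (rule dist_ell2_def sgn_ell2_def uniformity_ell2_def open_ell2_def norm_ell2_def)+
end

lemma norm_ell2_sq: "(norm f)\<^sup>2 = (\<Sum>\<^sub>\<infinity>x. (cmod (Rep_ell2 f x))\<^sup>2)" for f :: "'a ell2"
  unfolding power2_norm_eq_inner[of f] inner_ell2_def by (simp add: dot_square_norm)

lift_definition scaleC :: "complex \<Rightarrow> 'a ell2 \<Rightarrow> 'a ell2" (infixr \<open>*\<^sub>C\<close> 75)
  is "\<lambda>c f x. c * f x"
  by (simp add: square_summable_cmult)

definition cinner :: "'a ell2 \<Rightarrow> 'a ell2 \<Rightarrow> complex" where
  "cinner f g = (\<Sum>\<^sub>\<infinity>x. Rep_ell2 f x * cnj (Rep_ell2 g x))"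

lift_definition ket :: "'a \<Rightarrow> 'a ell2" is "\<lambda>a x. if x = a then 1 else 0"
proof -
  fix a :: 'a
  let ?f = "\<lambda>x. (cmod (if x = a then 1 else 0))\<^sup>2"
  have "?f summable_on {a}" by (rule summable_on_finite) simp
  moreover have "?f summable_on UNIV \<longleftrightarrow> ?f summable_on {a}"
    by (rule summable_on_cong_neutral) auto
  ultimately show "?f summable_on UNIV" by simp
qed

lemma ell2_eqI: "(\<And>x. Rep_ell2 f x = Rep_ell2 g x) \<Longrightarrow> f = g"
  by (simp add: Rep_ell2_inject[symmetric] fun_eq_iff)

lemma Rep_ell2_sum: "Rep_ell2 (\<Sum>i\<in>F. f i) x = (\<Sum>i\<in>F. Rep_ell2 (f i) x)"
  by (induction F rule: infinite_finite_induct) (simp_all add: zero_ell2.rep_eq plus_ell2.rep_eq)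

lemma scaleC_add_right: "c *\<^sub>C (f + g) = c *\<^sub>C f + c *\<^sub>C g"
  by (rule ell2_eqI) (simp add: scaleC.rep_eq plus_ell2.rep_eq algebra_simps)

lemma scaleC_scaleC: "c *\<^sub>C d *\<^sub>C f = (c * d) *\<^sub>C f"
  by (rule ell2_eqI) (simp add: scaleC.rep_eq)

lemma scaleC_scaleR: "c *\<^sub>C r *\<^sub>R f = r *\<^sub>R c *\<^sub>C f"
  by (rule ell2_eqI) (simp add: scaleC.rep_eq scaleR_ell2.rep_eq)

lemma norm_scaleC: "norm (c *\<^sub>C f) = cmod c * norm f"
proof -
  have "(norm (c *\<^sub>C f))\<^sup>2 = (cmod c * norm f)\<^sup>2"
    unfolding power_mult_distrib norm_ell2_sq scaleC.rep_eq norm_mult by (rule infsum_cmult_right')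
  then show ?thesis by (rule power2_eq_imp_eq) simp_all
qed

lemma cinner_summable: "(\<lambda>x. Rep_ell2 f x * cnj (Rep_ell2 g x)) summable_on A"
proof (rule abs_summable_summable)
  show "(\<lambda>x. cmod (Rep_ell2 f x * cnj (Rep_ell2 g x))) summable_on A"
    using ell2_summable_product[of f g A] by (simp add: norm_mult)
qed

lemma cinner_add_left: "cinner (f + g) h = cinner f h + cinner g h"
  unfolding cinner_def plus_ell2.rep_eq distrib_right
  by (intro infsum_add cinner_summable)

lemma cinner_scaleC_left: "cinner (c *\<^sub>C f) g = c * cinner f g"
  by (simp add: cinner_def scaleC.rep_eq mult.assoc infsum_cmult_right')

lemma cinner_commute: "cinner g f = cnj (cinner f g)"
proof -
  have "(\<lambda>x. Rep_ell2 g x * cnj (Rep_ell2 f x)) = (\<lambda>x. cnj (Rep_ell2 f x * cnj (Rep_ell2 g x)))"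
    by (simp add: fun_eq_iff)
  then show ?thesis unfolding cinner_def by (simp only: infsum_cnj)
qed

lemma cinner_add_right: "cinner h (f + g) = cinner h f + cinner h g"
  unfolding cinner_commute[of h] cinner_add_left by simp

lemma cinner_scaleC_right: "cinner f (c *\<^sub>C g) = cnj c * cinner f g"
  unfolding cinner_commute[of f] cinner_scaleC_left by simp

lemma cinner_zero_left: "cinner 0 f = 0"
  by (simp add: cinner_def zero_ell2.rep_eq)

lemma cinner_sum_left: "cinner (\<Sum>i\<in>F. f i) h = (\<Sum>i\<in>F. cinner (f i) h)"
  by (induction F rule: infinite_finite_induct) (simp_all add: cinner_zero_left cinner_add_left)

lemma Re_cinner: "Re (cinner f g) = inner f g"
  unfolding cinner_def inner_ell2_def infsum_Re[OF cinner_summable, symmetric]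
  by (simp add: inner_complex_def)

lemma cinner_bound: "cmod (cinner f g) \<le> norm f * norm g"
proof (cases "cinner f g = 0")
  case False
  define u where "u = cnj (cinner f g) / cmod (cinner f g)"
  have u: "cmod u = 1" using False by (simp add: u_def norm_divide)
  have "u * cinner f g = (cinner f g * cnj (cinner f g)) / cmod (cinner f g)"
    by (simp add: u_def)
  also have "\<dots> = cmod (cinner f g)"
    unfolding complex_norm_square[symmetric] using False by (simp add: power2_eq_square)
  finally have "u * cinner f g = cmod (cinner f g)" .
  then have "cmod (cinner f g) = Re (cinner (u *\<^sub>C f) g)"
    by (simp add: cinner_scaleC_left)
  also have "\<dots> \<le> norm (u *\<^sub>C f) * norm g"
    by (simp add: Re_cinner norm_cauchy_schwarz)
  finally show ?thesis by (simp add: norm_scaleC u)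
qed simp

lemma infsum_single:
  fixes f :: "'a \<Rightarrow> 'b :: {t2_space, comm_monoid_add}"
  assumes "\<And>x. x \<noteq> a \<Longrightarrow> f x = 0"
  shows "infsum f UNIV = f a"
proof -
  have "infsum f UNIV = infsum f {a}"
    by (rule infsum_cong_neutral) (use assms in auto)
  then show ?thesis by simp
qed

lemma cinner_ket_right: "cinner f (ket a) = Rep_ell2 f a"
  unfolding cinner_def by (subst infsum_single[of a]) (simp_all add: ket.rep_eq)

lemma ell2_memI:
  assumes "\<And>F. finite F \<Longrightarrow> (\<Sum>x\<in>F. (cmod (f x))\<^sup>2) \<le> C"
  shows "f \<in> {f. (\<lambda>x. (cmod (f x))\<^sup>2) summable_on UNIV}"
    and "(\<Sum>\<^sub>\<infinity>x. (cmod (f x))\<^sup>2) \<le> C"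
proof -
  have "(\<lambda>x. (cmod (f x))\<^sup>2) summable_on UNIV"
    by (rule nonneg_bdd_above_summable_on) (use assms in \<open>auto simp: bdd_above_def\<close>)
  then show "f \<in> {f. (\<lambda>x. (cmod (f x))\<^sup>2) summable_on UNIV}"
    "(\<Sum>\<^sub>\<infinity>x. (cmod (f x))\<^sup>2) \<le> C"
    using assms by (auto intro: infsum_le_finite_sums)
qed

lemma Rep_scaleC_ket: "Rep_ell2 (c *\<^sub>C ket x) y = (if y = x then c else 0)"
  by (simp add: scaleC.rep_eq ket.rep_eq)

lemma norm_ket_combination:
  assumes "finite F"
  shows "(norm (\<Sum>x\<in>F. c x *\<^sub>C ket x))\<^sup>2 = (\<Sum>x\<in>F. (cmod (c x))\<^sup>2)"
proof -
  have "Rep_ell2 (\<Sum>x\<in>F. c x *\<^sub>C ket x) y = (if y \<in> F then c y else 0)" for y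
    using assms by (simp add: Rep_ell2_sum Rep_scaleC_ket)
  then have "(norm (\<Sum>x\<in>F. c x *\<^sub>C ket x))\<^sup>2 = (\<Sum>\<^sub>\<infinity>y. (cmod (if y \<in> F then c y else 0))\<^sup>2)"
    by (simp add: norm_ell2_sq)
  also have "\<dots> = (\<Sum>\<^sub>\<infinity>y\<in>F. (cmod (c y))\<^sup>2)"
    by (rule infsum_cong_neutral) auto
  finally show ?thesis using assms by simp
qed

lemma ket_approx:
  assumes "e > 0"
  obtains F where "finite F" "norm (f - (\<Sum>x\<in>F. Rep_ell2 f x *\<^sub>C ket x)) < e"
proof -
  let ?g = "\<lambda>x. (cmod (Rep_ell2 f x))\<^sup>2"
  obtain F where F: "finite F" "dist (sum ?g F) (infsum ?g UNIV) \<le> e\<^sup>2 / 2"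
    using infsum_finite_approximation[OF ell2_summable[of f UNIV], of "e\<^sup>2 / 2"] assms by auto
  let ?h = "f - (\<Sum>x\<in>F. Rep_ell2 f x *\<^sub>C ket x)"
  have rep: "Rep_ell2 ?h y = (if y \<in> F then 0 else Rep_ell2 f y)" for y
    using F(1)
    by (simp add: minus_ell2.rep_eq Rep_ell2_sum Rep_scaleC_ket)
  have "(norm ?h)\<^sup>2 = infsum ?g (- F)"
    unfolding norm_ell2_sq rep by (rule infsum_cong_neutral) auto
  moreover have "infsum ?g UNIV = infsum ?g F + infsum ?g (- F)"
    using infsum_Un_disjoint[of ?g F "- F"] ell2_summable[of f] by simp
  ultimately have "(norm ?h)\<^sup>2 \<le> e\<^sup>2 / 2"
    using F by (simp add: dist_real_def)
  also have "\<dots> < e\<^sup>2" using assms by simp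
  finally have "norm ?h < e" using assms by (simp add: power_less_imp_less_base)
  with F(1) that show ?thesis by blast
qed


section \<open>Bounded operators\<close>

text \<open>The type \<open>'a ell2 \<Rightarrow>\<^sub>L 'b ell2\<close> consists of the bounded real-linear maps, with the operator
  norm; the bounded operators in the usual sense are its complex-linear elements.\<close>

definition clinear_op :: "('a ell2 \<Rightarrow>\<^sub>L 'b ell2) \<Rightarrow> bool" where
  "clinear_op T \<longleftrightarrow> (\<forall>c f. T (c *\<^sub>C f) = c *\<^sub>C T f)"

definition scale_op :: "complex \<Rightarrow> ('a ell2 \<Rightarrow>\<^sub>L 'b ell2) \<Rightarrow> ('a ell2 \<Rightarrow>\<^sub>L 'b ell2)" where
  "scale_op c T = Blinfun (\<lambda>f. c *\<^sub>C T f)"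

lemma scale_op_apply: "scale_op c T f = c *\<^sub>C T f"
proof -
  have "bounded_linear (\<lambda>f. c *\<^sub>C T f)"
  proof (rule bounded_linear_intro)
    show "norm (c *\<^sub>C T f) \<le> norm f * (cmod c * norm T)" for f
      using mult_left_mono[OF norm_blinfun[of T f] norm_ge_zero[of c]]
      by (simp add: norm_scaleC mult_ac)
  qed (simp_all add: blinfun.add_right blinfun.scaleR_right scaleC_add_right scaleC_scaleR)
  then show ?thesis by (simp add: scale_op_def bounded_linear_Blinfun_apply)
qed

lemma clinear_op_eqI:
  fixes S T :: "'a ell2 \<Rightarrow>\<^sub>L 'b ell2"
  assumes "clinear_op S" "clinear_op T" "\<And>x. S (ket x) = T (ket x)"
  shows "S = T"
proof (rule blinfun_eqI, rule ccontr)
  fix f assume ne: "S f \<noteq> T f"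
  have zero: "(S - T) (\<Sum>x\<in>F. c x *\<^sub>C ket x) = 0" for F c
    using assms by (simp add: blinfun.sum_right blinfun.diff_left clinear_op_def)
  define e where "e = norm (S f - T f) / (norm (S - T) + 1)"
  have pos: "norm (S - T) + 1 > 0" by (simp add: add_nonneg_pos)
  then have "e > 0" using ne by (simp add: e_def)
  then obtain F where F: "norm (f - (\<Sum>x\<in>F. Rep_ell2 f x *\<^sub>C ket x)) < e"
    using ket_approx by blast
  have "norm (S f - T f) = norm ((S - T) (f - (\<Sum>x\<in>F. Rep_ell2 f x *\<^sub>C ket x)))"
    by (simp add: blinfun.diff_right zero) (simp add: blinfun.diff_left)
  also have "\<dots> \<le> norm (S - T) * e"
    using norm_blinfun[of "S - T"] F by (meson less_imp_le mult_left_mono norm_ge_zero order_trans)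
  also have "\<dots> < (norm (S - T) + 1) * e" using \<open>e > 0\<close> by simp
  also have "\<dots> = norm (S f - T f)" using pos by (simp add: e_def)
  finally show False by simp
qed

definition adj :: "('a ell2 \<Rightarrow>\<^sub>L 'b ell2) \<Rightarrow> ('b ell2 \<Rightarrow>\<^sub>L 'a ell2)" where
  "adj T = (THE S. \<forall>f g. cinner (T f) g = cinner f (blinfun_apply S g))"

lemma adj_ex1:
  fixes T :: "'a ell2 \<Rightarrow>\<^sub>L 'b ell2"
  assumes T: "clinear_op T"
  shows "\<exists>!S. \<forall>f g. cinner (T f) g = cinner f (blinfun_apply S g)"
proof (rule ex_ex1I)
  define h where "h g x = cnj (cinner (T (ket x)) g)" for g x
  have bound: "(\<Sum>x\<in>F. (cmod (h g x))\<^sup>2) \<le> (norm T * norm g)\<^sup>2" if "finite F" for g F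
  proof -
    define f where "f = (\<Sum>x\<in>F. h g x *\<^sub>C ket x)"
    have nf: "(norm f)\<^sup>2 = (\<Sum>x\<in>F. (cmod (h g x))\<^sup>2)"
      unfolding f_def by (rule norm_ket_combination[OF that])
    have "cinner (T f) g = (\<Sum>x\<in>F. h g x * cinner (T (ket x)) g)"
      using T by (simp add: f_def blinfun.sum_right clinear_op_def cinner_sum_left cinner_scaleC_left)
    also have "\<dots> = (\<Sum>x\<in>F. of_real ((cmod (h g x))\<^sup>2))"
      by (intro sum.cong refl) (simp only: h_def complex_norm_square complex_cnj_cnj)
    also have "\<dots> = of_real ((norm f)\<^sup>2)" by (simp only: nf of_real_sum)
    finally have "(norm f)\<^sup>2 = cmod (cinner (T f) g)" by (simp only: norm_of_real abs_power2)
    also have "\<dots> \<le> norm (T f) * norm g" by (rule cinner_bound)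
    also have "\<dots> \<le> (norm T * norm f) * norm g" by (intro mult_right_mono norm_blinfun) simp
    finally have "norm f * norm f \<le> norm f * (norm T * norm g)"
      by (simp add: power2_eq_square mult_ac)
    then have "norm f \<le> norm T * norm g"
      by (cases "norm f = 0") (auto simp: mult_le_cancel_left)
    then show ?thesis unfolding nf[symmetric] by (intro power_mono) simp_all
  qed
  define A where "A g = Abs_ell2 (h g)" for g
  have rep: "Rep_ell2 (A g) = h g" for g
    unfolding A_def by (rule Abs_ell2_inverse) (rule ell2_memI(1), rule bound)
  have bl: "bounded_linear A"
  proof (rule bounded_linear_intro)
    show "A (f + g) = A f + A g" for f g
      by (rule ell2_eqI) (simp add: rep plus_ell2.rep_eq h_def cinner_add_right)
    show "A (r *\<^sub>R g) = r *\<^sub>R A g" for r g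
    proof -
      have "r *\<^sub>R g = of_real r *\<^sub>C g"
        by (rule ell2_eqI) (simp add: scaleR_ell2.rep_eq scaleC.rep_eq scaleR_conv_of_real)
      then show ?thesis
        by (intro ell2_eqI)
           (simp add: rep scaleR_ell2.rep_eq h_def cinner_scaleC_right scaleR_conv_of_real)
    qed
    show "norm (A g) \<le> norm g * norm T" for g
    proof -
      have "(norm (A g))\<^sup>2 \<le> (norm T * norm g)\<^sup>2"
        unfolding norm_ell2_sq rep by (rule ell2_memI(2), rule bound)
      then have "norm (A g) \<le> norm T * norm g" by (rule power2_le_imp_le) simp
      then show ?thesis by (simp only: mult.commute)
    qed
  qed
  have "cinner (T f) g = cinner f (A g)" for f g
  proof (rule ccontr)
    assume ne: "cinner (T f) g \<noteq> cinner f (A g)"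
    define D where "D f = cinner (T f) g - cinner f (A g)" for f
    have D0: "D (\<Sum>x\<in>F. c x *\<^sub>C ket x) = 0" for F c
    proof -
      have "cinner (ket x) (A g) = cinner (T (ket x)) g" for x
        by (subst cinner_commute) (simp add: cinner_ket_right rep h_def)
      then show ?thesis using T
        by (simp add: D_def blinfun.sum_right clinear_op_def cinner_sum_left cinner_scaleC_left)
    qed
    have Dadd: "D (u + v) = D u + D v" for u v
      by (simp add: D_def blinfun.add_right cinner_add_left)
    define C where "C = norm T * norm g + norm (A g)"
    have Db: "cmod (D u) \<le> C * norm u" for u
    proof -
      have "cmod (D u) \<le> cmod (cinner (T u) g) + cmod (cinner u (A g))"
        unfolding D_def by (rule norm_triangle_ineq4)
      also have "\<dots> \<le> norm (T u) * norm g + norm u * norm (A g)"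
        by (intro add_mono cinner_bound)
      also have "\<dots> \<le> (norm T * norm u) * norm g + norm u * norm (A g)"
        by (intro add_mono mult_right_mono norm_blinfun order_refl) simp
      finally show ?thesis by (simp add: C_def algebra_simps)
    qed
    have C: "C \<ge> 0" by (simp add: C_def)
    define e where "e = cmod (D f) / (C + 1)"
    have "e > 0" using ne C by (simp add: e_def D_def)
    then obtain F where F: "norm (f - (\<Sum>x\<in>F. Rep_ell2 f x *\<^sub>C ket x)) < e"
      using ket_approx by blast
    have "D f = D (f - (\<Sum>x\<in>F. Rep_ell2 f x *\<^sub>C ket x))"
      using Dadd[of "f - (\<Sum>x\<in>F. Rep_ell2 f x *\<^sub>C ket x)" "\<Sum>x\<in>F. Rep_ell2 f x *\<^sub>C ket x"]
      by (simp add: D0)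
    then have "cmod (D f) \<le> C * norm (f - (\<Sum>x\<in>F. Rep_ell2 f x *\<^sub>C ket x))"
      using Db[of "f - (\<Sum>x\<in>F. Rep_ell2 f x *\<^sub>C ket x)"] by (simp only:)
    also have "\<dots> \<le> C * e" using F C by (intro mult_left_mono) simp_all
    also have "\<dots> < (C + 1) * e" using \<open>e > 0\<close> by simp
    also have "\<dots> = cmod (D f)" using C by (simp add: e_def)
    finally show False by simp
  qed
  then show "\<exists>S. \<forall>f g. cinner (T f) g = cinner f (blinfun_apply S g)"
    by (intro exI[of _ "Blinfun A"]) (simp add: bounded_linear_Blinfun_apply[OF bl])
next
  fix S S' :: "'b ell2 \<Rightarrow>\<^sub>L 'a ell2"
  assume "\<forall>f g. cinner (T f) g = cinner f (S g)" "\<forall>f g. cinner (T f) g = cinner f (S' g)"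
  then have "cinner (ket x) (S g) = cinner (ket x) (S' g)" for x g by metis
  then have "cinner (S g) (ket x) = cinner (S' g) (ket x)" for x g
    using cinner_commute[of "ket x" "S g"] cinner_commute[of "ket x" "S' g"] by simp
  then show "S = S'"
    by (intro blinfun_eqI ell2_eqI) (simp add: cinner_ket_right)
qed

lemma cinner_adj: "clinear_op T \<Longrightarrow> cinner (T f) g = cinner f (adj T g)"
  using theI'[OF adj_ex1[of T]] unfolding adj_def by blast

text \<open>The extension of an injection of index sets to an isometry.\<close>

lemma pushforward_ex:
  fixes \<phi> :: "'a \<Rightarrow> 'b"
  assumes "inj \<phi>"
  obtains V where "clinear_op V" "\<And>f x. Rep_ell2 (blinfun_apply V f) (\<phi> x) = Rep_ell2 f x"
    "\<And>f y. y \<notin> range \<phi> \<Longrightarrow> Rep_ell2 (blinfun_apply V f) y = 0"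
proof -
  define h where "h f y = (if y \<in> range \<phi> then Rep_ell2 f (inv \<phi> y) else 0)" for f y
  have hs: "((\<lambda>y. (cmod (h f y))\<^sup>2) has_sum (norm f)\<^sup>2) UNIV" for f
  proof -
    have "((\<lambda>x. (cmod (Rep_ell2 f x))\<^sup>2) has_sum (norm f)\<^sup>2) UNIV"
      unfolding norm_ell2_sq by (rule has_sum_infsum[OF ell2_summable])
    also have "(\<lambda>x. (cmod (Rep_ell2 f x))\<^sup>2) = (\<lambda>y. (cmod (h f y))\<^sup>2) \<circ> \<phi>"
      using assms by (auto simp: h_def fun_eq_iff)
    finally have "((\<lambda>y. (cmod (h f y))\<^sup>2) has_sum (norm f)\<^sup>2) (range \<phi>)"
      by (simp only: has_sum_reindex[OF assms])
    moreover have "((\<lambda>y. (cmod (h f y))\<^sup>2) has_sum (norm f)\<^sup>2) (range \<phi>) \<longleftrightarrow>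
        ((\<lambda>y. (cmod (h f y))\<^sup>2) has_sum (norm f)\<^sup>2) UNIV"
      by (rule has_sum_cong_neutral) (auto simp: h_def)
    ultimately show ?thesis by simp
  qed
  define V where "V f = Abs_ell2 (h f)" for f
  have rep: "Rep_ell2 (V f) = h f" for f
    unfolding V_def by (rule Abs_ell2_inverse) (use hs[of f] in \<open>auto simp: summable_on_def\<close>)
  have bl: "bounded_linear V"
  proof (rule bounded_linear_intro)
    show "norm (V f) \<le> norm f * 1" for f
    proof -
      have "(norm (V f))\<^sup>2 = (norm f)\<^sup>2"
        unfolding norm_ell2_sq[of "V f"] rep by (rule infsumI[OF hs])
      then show ?thesis by simp
    qed
  qed (auto intro!: ell2_eqI simp: rep h_def plus_ell2.rep_eq scaleR_ell2.rep_eq)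
  show ?thesis
    by (rule that[of "Blinfun V"])
       (use assms in \<open>auto intro!: ell2_eqI
         simp: clinear_op_def bounded_linear_Blinfun_apply[OF bl] rep h_def scaleC.rep_eq\<close>)
qed


section \<open>Tensor products\<close>

text \<open>We use the canonical identification of the Hilbert space tensor product of
  \<open>\<ell>\<^sup>2(X)\<close> and \<open>\<ell>\<^sup>2(Y)\<close> with \<open>\<ell>\<^sup>2(X \<times> Y)\<close>.\<close>

lift_definition tensor_vec :: "'a ell2 \<Rightarrow> 'b ell2 \<Rightarrow> ('a \<times> 'b) ell2" (infixr \<open>\<otimes>\<^sub>v\<close> 70)
  is "\<lambda>f g (x, y). f x * g y"
proof -
  fix f :: "'a \<Rightarrow> complex" and g :: "'b \<Rightarrow> complex"
  assume f: "(\<lambda>x. (cmod (f x))\<^sup>2) summable_on UNIV"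
    and g: "(\<lambda>x. (cmod (g x))\<^sup>2) summable_on UNIV"
  have "(\<lambda>z. (cmod (case z of (x, y) \<Rightarrow> f x * g y))\<^sup>2) summable_on UNIV \<times> UNIV"
  proof (rule summable_on_SigmaI)
    fix x
    show "((\<lambda>y. (cmod (case (x, y) of (x, y) \<Rightarrow> f x * g y))\<^sup>2) has_sum
        (cmod (f x))\<^sup>2 * (\<Sum>\<^sub>\<infinity>y. (cmod (g y))\<^sup>2)) UNIV"
      using has_sum_cmult_right[OF has_sum_infsum, of "\<lambda>y. (cmod (g y))\<^sup>2" UNIV "(cmod (f x))\<^sup>2"] g
      by (simp add: norm_mult power_mult_distrib)
  next
    show "(\<lambda>x. (cmod (f x))\<^sup>2 * (\<Sum>\<^sub>\<infinity>y. (cmod (g y))\<^sup>2)) summable_on UNIV"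
      using f by (intro summable_on_cmult_left) simp
  qed simp
  then show "(\<lambda>z. (cmod (case z of (x, y) \<Rightarrow> f x * g y))\<^sup>2) summable_on UNIV"
    by simp
qed

lemma tensor_vec_ket: "ket x \<otimes>\<^sub>v ket y = ket (x, y)"
  by (rule ell2_eqI) (auto simp: tensor_vec.rep_eq ket.rep_eq split: prod.splits)

definition tensor_op ::
  "('a ell2 \<Rightarrow>\<^sub>L 'c ell2) \<Rightarrow> ('b ell2 \<Rightarrow>\<^sub>L 'd ell2) \<Rightarrow> (('a \<times> 'b) ell2 \<Rightarrow>\<^sub>L ('c \<times> 'd) ell2)"
  (infixr \<open>\<otimes>\<^sub>o\<close> 70) where
  "T \<otimes>\<^sub>o S = (THE R. clinear_op R \<and> (\<forall>f g. blinfun_apply R (f \<otimes>\<^sub>v g) = T f \<otimes>\<^sub>v S g))"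

lemma amplification_ex:
  fixes S :: "'b ell2 \<Rightarrow>\<^sub>L 'd ell2"
  assumes S: "clinear_op S"
  shows "\<exists>R :: ('a \<times> 'b) ell2 \<Rightarrow>\<^sub>L ('a \<times> 'd) ell2.
    clinear_op R \<and> (\<forall>f g. R (f \<otimes>\<^sub>v g) = f \<otimes>\<^sub>v S g)"
proof -
  define row where "row f x = Abs_ell2 (\<lambda>y. Rep_ell2 f (x, y))"
    for f :: "('a \<times> 'b) ell2" and x
  have s2: "(\<lambda>(x, y). (cmod (Rep_ell2 f (x, y)))\<^sup>2) summable_on UNIV \<times> UNIV"
    for f :: "('a \<times> 'b) ell2"
    using ell2_summable[of f UNIV] by (simp add: case_prod_unfold)
  have rrow: "Rep_ell2 (row f x) = (\<lambda>y. Rep_ell2 f (x, y))" for f x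
    unfolding row_def
    by (rule Abs_ell2_inverse) (use summable_on_SigmaD1[OF s2, of x f] in simp)
  have rows: "((\<lambda>x. (norm (row f x))\<^sup>2) has_sum (norm f)\<^sup>2) UNIV" for f
  proof (rule has_sum_SigmaD)
    show "((\<lambda>z. (cmod (Rep_ell2 f z))\<^sup>2) has_sum (norm f)\<^sup>2) (UNIV \<times> UNIV)"
      unfolding norm_ell2_sq using has_sum_infsum[OF ell2_summable[of f UNIV]] by simp
    show "((\<lambda>y. (cmod (Rep_ell2 f (x, y)))\<^sup>2) has_sum (norm (row f x))\<^sup>2) UNIV" for x
      using has_sum_infsum[OF ell2_summable[of "row f x" UNIV]]
      by (simp add: norm_ell2_sq rrow)
  qed
  define h where "h f = (\<lambda>(x, y). Rep_ell2 (S (row f x)) y)" for f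
  have inner_sum: "((\<lambda>y. (cmod (h f (x, y)))\<^sup>2) has_sum (norm (S (row f x)))\<^sup>2) UNIV" for f x
    unfolding norm_ell2_sq h_def using has_sum_infsum[OF ell2_summable] by simp
  have row_le: "(norm (S (row f x)))\<^sup>2 \<le> (norm S)\<^sup>2 * (norm (row f x))\<^sup>2" for f x
    using power_mono[OF norm_blinfun[of S "row f x"], of 2] by (simp add: power_mult_distrib)
  have row_sum: "(\<lambda>x. (norm S)\<^sup>2 * (norm (row f x))\<^sup>2) summable_on UNIV" for f
    using rows[of f] by (intro summable_on_cmult_right) (auto simp: summable_on_def)
  have Srow_sum: "(\<lambda>x. (norm (S (row f x)))\<^sup>2) summable_on UNIV" for f
    by (rule summable_on_comparison_test[OF row_sum]) (rule row_le, simp)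
  have h_sum: "(\<lambda>z. (cmod (h f z))\<^sup>2) summable_on UNIV \<times> UNIV" for f
    by (rule summable_on_SigmaI[OF inner_sum Srow_sum]) simp
  define R where "R f = Abs_ell2 (h f)" for f
  have rep: "Rep_ell2 (R f) = h f" for f
    unfolding R_def by (rule Abs_ell2_inverse) (use h_sum[of f] in simp)
  have R_norm: "norm (R f) \<le> norm f * norm S" for f
  proof -
    have "(norm (R f))\<^sup>2 = (\<Sum>\<^sub>\<infinity>x. (norm (S (row f x)))\<^sup>2)"
      using has_sum_SigmaD[OF has_sum_infsum[OF h_sum] inner_sum, of f]
      by (simp add: norm_ell2_sq[of "R f"] rep infsumI)
    also have "\<dots> \<le> (\<Sum>\<^sub>\<infinity>x. (norm S)\<^sup>2 * (norm (row f x))\<^sup>2)"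
      by (rule infsum_mono[OF Srow_sum row_sum row_le])
    also have "\<dots> = (norm S)\<^sup>2 * (norm f)\<^sup>2"
      using infsumI[OF rows[of f]] by (simp add: infsum_cmult_right')
    also have "\<dots> = (norm f * norm S)\<^sup>2" by (simp add: power_mult_distrib)
    finally show ?thesis by (rule power2_le_imp_le) simp
  qed
  have row_add: "row (f + g) x = row f x + row g x" for f g x
    by (rule ell2_eqI) (simp add: rrow plus_ell2.rep_eq)
  have row_scaleR: "row (r *\<^sub>R f) x = r *\<^sub>R row f x" for r f x
    by (rule ell2_eqI) (simp add: rrow scaleR_ell2.rep_eq)
  have row_scaleC: "row (c *\<^sub>C f) x = c *\<^sub>C row f x" for c f x
    by (rule ell2_eqI) (simp add: rrow scaleC.rep_eq)
  have row_tensor: "row (f \<otimes>\<^sub>v g) x = Rep_ell2 f x *\<^sub>C g" for f g x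
    by (rule ell2_eqI) (simp add: rrow scaleC.rep_eq tensor_vec.rep_eq)
  have bl: "bounded_linear R"
    by (rule bounded_linear_intro[OF _ _ R_norm])
       (auto intro!: ell2_eqI simp: rep h_def plus_ell2.rep_eq scaleR_ell2.rep_eq row_add
         row_scaleR blinfun.add_right blinfun.scaleR_right)
  show ?thesis
    by (rule exI[of _ "Blinfun R"])
       (use S in \<open>auto intro!: ell2_eqI simp: clinear_op_def bounded_linear_Blinfun_apply[OF bl]
         rep h_def row_scaleC row_tensor scaleC.rep_eq tensor_vec.rep_eq\<close>)
qed

lemma swap_ex:
  "\<exists>W :: ('x \<times> 'y) ell2 \<Rightarrow>\<^sub>L ('y \<times> 'x) ell2.
      clinear_op W \<and> (\<forall>f g. W (f \<otimes>\<^sub>v g) = g \<otimes>\<^sub>v f)"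
proof -
  obtain W :: "('x \<times> 'y) ell2 \<Rightarrow>\<^sub>L ('y \<times> 'x) ell2" where W: "clinear_op W"
    "\<And>f x. Rep_ell2 (blinfun_apply W f) (prod.swap x) = Rep_ell2 f x"
    using pushforward_ex[of "prod.swap :: 'x \<times> 'y \<Rightarrow> 'y \<times> 'x"] by auto
  have "W (f \<otimes>\<^sub>v g) = g \<otimes>\<^sub>v f" for f g
  proof (rule ell2_eqI)
    fix z :: "'y \<times> 'x"
    show "Rep_ell2 (W (f \<otimes>\<^sub>v g)) z = Rep_ell2 (g \<otimes>\<^sub>v f) z"
      using W(2)[of "f \<otimes>\<^sub>v g" "prod.swap z"]
      by (cases z) (simp add: tensor_vec.rep_eq mult.commute)
  qed
  with W(1) show ?thesis by blast
qed

lemma tensor_op_ex1: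
  fixes T :: "'a ell2 \<Rightarrow>\<^sub>L 'c ell2" and S :: "'b ell2 \<Rightarrow>\<^sub>L 'd ell2"
  assumes "clinear_op T" "clinear_op S"
  shows "\<exists>!R :: ('a \<times> 'b) ell2 \<Rightarrow>\<^sub>L ('c \<times> 'd) ell2.
    clinear_op R \<and> (\<forall>f g. R (f \<otimes>\<^sub>v g) = T f \<otimes>\<^sub>v S g)"
proof (rule ex_ex1I)
  obtain W1 :: "('a \<times> 'd) ell2 \<Rightarrow>\<^sub>L ('d \<times> 'a) ell2"
    where W1: "clinear_op W1" "\<And>f g. W1 (f \<otimes>\<^sub>v g) = g \<otimes>\<^sub>v f" using swap_ex by blast
  obtain W2 :: "('d \<times> 'c) ell2 \<Rightarrow>\<^sub>L ('c \<times> 'd) ell2"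
    where W2: "clinear_op W2" "\<And>f g. W2 (f \<otimes>\<^sub>v g) = g \<otimes>\<^sub>v f" using swap_ex by blast
  obtain R1 :: "('a \<times> 'b) ell2 \<Rightarrow>\<^sub>L ('a \<times> 'd) ell2"
    where R1: "clinear_op R1" "\<And>f g. R1 (f \<otimes>\<^sub>v g) = f \<otimes>\<^sub>v S g"
    using amplification_ex[OF assms(2)] by blast
  obtain R2 :: "('d \<times> 'a) ell2 \<Rightarrow>\<^sub>L ('d \<times> 'c) ell2"
    where R2: "clinear_op R2" "\<And>f g. R2 (f \<otimes>\<^sub>v g) = f \<otimes>\<^sub>v T g"
    using amplification_ex[OF assms(1)] by blast
  show "\<exists>R :: ('a \<times> 'b) ell2 \<Rightarrow>\<^sub>L ('c \<times> 'd) ell2.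
      clinear_op R \<and> (\<forall>f g. R (f \<otimes>\<^sub>v g) = T f \<otimes>\<^sub>v S g)"
    using W1 W2 R1 R2
    by (intro exI[of _ "W2 o\<^sub>L R2 o\<^sub>L W1 o\<^sub>L R1"]) (simp add: clinear_op_def)
next
  fix R R' :: "('a \<times> 'b) ell2 \<Rightarrow>\<^sub>L ('c \<times> 'd) ell2"
  assume R: "clinear_op R \<and> (\<forall>f g. R (f \<otimes>\<^sub>v g) = T f \<otimes>\<^sub>v S g)"
    and R': "clinear_op R' \<and> (\<forall>f g. R' (f \<otimes>\<^sub>v g) = T f \<otimes>\<^sub>v S g)"
  have "R (ket z) = R' (ket z)" for z
    using R R' tensor_vec_ket[of "fst z" "snd z"] by (metis prod.collapse)
  with R R' show "R = R'" by (blast intro: clinear_op_eqI)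
qed

lemma tensor_op:
  assumes "clinear_op T" "clinear_op S"
  shows "clinear_op (T \<otimes>\<^sub>o S)" "(T \<otimes>\<^sub>o S) (f \<otimes>\<^sub>v g) = T f \<otimes>\<^sub>v S g"
  using theI'[OF tensor_op_ex1[OF assms]] unfolding tensor_op_def by blast+


section \<open>Concrete C*-algebras\<close>

text \<open>All C*-algebras below are norm-closed *-subalgebras of the bounded operators on some
  \<open>\<ell>\<^sup>2(X)\<close>; accordingly the minimal tensor product is the spatial one, the closure of the
  algebraic tensor product in the bounded operators on \<open>\<ell>\<^sup>2(X \<times> Y)\<close>.\<close>

definition cstar_subalgebra :: "('a ell2 \<Rightarrow>\<^sub>L 'a ell2) set \<Rightarrow> bool" where
  "cstar_subalgebra A \<longleftrightarrow>
     (\<forall>T\<in>A. clinear_op T) \<and> 0 \<in> A \<and>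
     (\<forall>S\<in>A. \<forall>T\<in>A. S + T \<in> A \<and> S o\<^sub>L T \<in> A) \<and>
     (\<forall>c. \<forall>T\<in>A. scale_op c T \<in> A) \<and>
     (\<forall>T\<in>A. adj T \<in> A) \<and> closed A"

definition cstar_generated :: "('a ell2 \<Rightarrow>\<^sub>L 'a ell2) set \<Rightarrow> ('a ell2 \<Rightarrow>\<^sub>L 'a ell2) set" where
  "cstar_generated G = \<Inter> {A. cstar_subalgebra A \<and> G \<subseteq> A}"

definition min_tensor ::
  "('a ell2 \<Rightarrow>\<^sub>L 'a ell2) set \<Rightarrow> ('b ell2 \<Rightarrow>\<^sub>L 'b ell2) set \<Rightarrow>
    (('a \<times> 'b) ell2 \<Rightarrow>\<^sub>L ('a \<times> 'b) ell2) set" (infixr \<open>\<otimes>\<^sub>m\<^sub>i\<^sub>n\<close> 70) where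
  "A \<otimes>\<^sub>m\<^sub>i\<^sub>n B =
     closure {\<Sum>i<n. T i \<otimes>\<^sub>o S i | (n :: nat) T S. (\<forall>i<n. T i \<in> A) \<and> (\<forall>i<n. S i \<in> B)}"

definition cstar_hom ::
  "('a ell2 \<Rightarrow>\<^sub>L 'a ell2) set \<Rightarrow> ('b ell2 \<Rightarrow>\<^sub>L 'b ell2) set \<Rightarrow>
    (('a ell2 \<Rightarrow>\<^sub>L 'a ell2) \<Rightarrow> ('b ell2 \<Rightarrow>\<^sub>L 'b ell2)) \<Rightarrow> bool" where
  "cstar_hom A B \<Phi> \<longleftrightarrow>
     (\<forall>T\<in>A. \<Phi> T \<in> B) \<and>
     (\<forall>S\<in>A. \<forall>T\<in>A. \<Phi> (S + T) = \<Phi> S + \<Phi> T \<and> \<Phi> (S o\<^sub>L T) = \<Phi> S o\<^sub>L \<Phi> T) \<and>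
     (\<forall>c. \<forall>T\<in>A. \<Phi> (scale_op c T) = scale_op c (\<Phi> T)) \<and>
     (\<forall>T\<in>A. \<Phi> (adj T) = adj (\<Phi> T))"


section \<open>Semigroups and constructible right ideals\<close>

definition left_ideal :: "'p::monoid_mult set \<Rightarrow> bool" where
  "left_ideal X \<longleftrightarrow> (\<forall>x\<in>X. \<forall>p. p * x \<in> X)"

definition right_ideal :: "'p::monoid_mult set \<Rightarrow> bool" where
  "right_ideal X \<longleftrightarrow> (\<forall>x\<in>X. \<forall>p. x * p \<in> X)"

definition cancellative :: "'p::monoid_mult itself \<Rightarrow> bool" where
  "cancellative _ \<longleftrightarrow>
     (\<forall>a b c :: 'p. a * b = a * c \<longrightarrow> b = c) \<and> (\<forall>a b c :: 'p. b * a = c * a \<longrightarrow> b = c)"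

definition left_Ore :: "'p::monoid_mult itself \<Rightarrow> bool" where
  "left_Ore P \<longleftrightarrow> cancellative P \<and>
     (\<forall>X Y :: 'p set. left_ideal X \<and> left_ideal Y \<and> X \<noteq> {} \<and> Y \<noteq> {} \<longrightarrow> X \<inter> Y \<noteq> {})"

inductive_set constructible :: "'p::monoid_mult set set" where
  empty: "{} \<in> constructible"
| UNIV: "UNIV \<in> constructible"
| translate: "X \<in> constructible \<Longrightarrow> (\<lambda>x. p * x) ` X \<in> constructible"
| pullback: "X \<in> constructible \<Longrightarrow> {q. p * q \<in> X} \<in> constructible"
| inter: "X \<in> constructible \<Longrightarrow> Y \<in> constructible \<Longrightarrow> X \<inter> Y \<in> constructible"

lemma constructible_right_ideal: "X \<in> constructible \<Longrightarrow> right_ideal X"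
proof (induction rule: constructible.induct)
  case (translate X p)
  show ?case
    unfolding right_ideal_def
  proof (intro ballI allI)
    fix y q assume "y \<in> (\<lambda>x. p * x) ` X"
    then obtain x where "x \<in> X" "y = p * x" by blast
    with translate.IH have "x * q \<in> X" "y * q = p * (x * q)"
      by (simp_all add: right_ideal_def mult.assoc)
    then show "y * q \<in> (\<lambda>x. p * x) ` X" by blast
  qed
next
  case (pullback X p)
  then show ?case by (simp add: right_ideal_def mult.assoc[symmetric])
qed (simp_all add: right_ideal_def)

text \<open>Only nonempty finite families are considered: the empty ideal is constructible and is the
  union of the empty family, so allowing that family would make the condition unsatisfiable.\<close>

definition constructible_independent :: "'p::monoid_mult itself \<Rightarrow> bool" where
  "constructible_independent _ \<longleftrightarrow>
     (\<forall>X \<in> (constructible :: 'p set set). \<forall>\<F> \<subseteq> constructible.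
        finite \<F> \<and> \<F> \<noteq> {} \<and> X = \<Union>\<F> \<longrightarrow> X \<in> \<F>)"

definition V_op :: "'p::monoid_mult \<Rightarrow> ('p ell2 \<Rightarrow>\<^sub>L 'p ell2)" where
  "V_op p = (THE T. clinear_op T \<and> (\<forall>x. blinfun_apply T (ket x) = ket (p * x)))"

lemma V_op_ex1:
  fixes p :: "'p::monoid_mult"
  assumes "cancellative TYPE('p)"
  shows "\<exists>!T :: 'p ell2 \<Rightarrow>\<^sub>L 'p ell2. clinear_op T \<and> (\<forall>x. T (ket x) = ket (p * x))"
proof (rule ex_ex1I)
  have inj: "inj ((*) p)"
    using assms unfolding cancellative_def inj_def by blast
  obtain T :: "'p ell2 \<Rightarrow>\<^sub>L 'p ell2" where T: "clinear_op T"
    "\<And>f x. Rep_ell2 (blinfun_apply T f) (p * x) = Rep_ell2 f x"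
    "\<And>f y. y \<notin> range ((*) p) \<Longrightarrow> Rep_ell2 (blinfun_apply T f) y = 0"
    using pushforward_ex[OF inj] by blast
  have "T (ket x) = ket (p * x)" for x
  proof (rule ell2_eqI)
    fix y
    show "Rep_ell2 (T (ket x)) y = Rep_ell2 (ket (p * x)) y"
      by (cases "y \<in> range ((*) p)")
         (use T(2,3) inj in \<open>auto simp: ket.rep_eq inj_eq\<close>)
  qed
  with T(1) show "\<exists>T :: 'p ell2 \<Rightarrow>\<^sub>L 'p ell2. clinear_op T \<and> (\<forall>x. T (ket x) = ket (p * x))"
    by blast
qed (metis clinear_op_eqI)

lemma V_op:
  fixes p :: "'p::monoid_mult"
  assumes "cancellative TYPE('p)"
  shows "clinear_op (V_op p)" "V_op p (ket x) = ket (p * x)"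
  using theI'[OF V_op_ex1[OF assms, of p]] unfolding V_op_def by blast+

definition reduced_cstar :: "'p::monoid_mult itself \<Rightarrow> ('p ell2 \<Rightarrow>\<^sub>L 'p ell2) set" where
  "reduced_cstar _ = cstar_generated (range (V_op :: 'p \<Rightarrow> _))"

end

theory Submission
  imports Defs
begin

text \<open>
  Existence of \<open>\<Delta>\<close> amounts to the estimate \<open>\<parallel>\<Sum>\<^sub>k c\<^sub>k m\<^sub>k \<otimes> m\<^sub>k\<parallel> \<le> \<parallel>\<Sum>\<^sub>k c\<^sub>k m\<^sub>k\<parallel>\<close> for monomials \<open>m\<^sub>k\<close> in the
  isometries \<open>V\<^sub>p\<close> and their adjoints: the linear combinations of monomials form a dense *-subalgebra of
  \<open>C\<^sup>*\<^sub>r(P)\<close>, and a contractive *-homomorphism on it extends by continuity (\<open>cstar_hom_extension\<close>).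

  In a left Ore monoid every monomial is a partial translation: on basis vectors it is multiplication
  by a left fraction \<open>a\<^sup>-\<^sup>1 b\<close>, defined on a constructible right ideal
  (\<open>monomial_partial_translation\<close>). Consequently \<open>m \<otimes> m\<close> moves the basis vectors of \<open>\<ell>\<^sup>2(P \<times> P)\<close> within the
  orbits of the diagonal left translation, and it suffices to prove the estimate on vectors
  supported in a finite subset \<open>F\<close> of one orbit; the orbits are orthogonal and are put together by Pythagoras
  (\<open>norm_finite_vector_le\<close>).

  On such a set, \<open>m \<otimes> m\<close> is defined at \<open>z = (x, y)\<close> iff both \<open>x\<close> and \<open>y\<close> lie in the domain \<open>X\<^sub>m\<close> of \<open>m\<close>.
  Independence of the constructible ideals provides a single point that lies in finitely many
  prescribed constructible ideals exactly when two given points do (\<open>independent_separation\<close>).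
  Applied after passing to a common left multiple of the points of \<open>F\<close>, this yields an injection
  \<open>\<theta>\<close> of \<open>F\<close> into \<open>P\<close> under which the finitely many monomials at hand act on \<open>\<theta>(F)\<close> in the same way as
  their diagonal versions act on \<open>F\<close> (\<open>local_intertwiner\<close>). The estimate is then immediate, because the
  vector has been carried isometrically to \<open>\<ell>\<^sup>2(P)\<close>.

  Uniqueness does not presuppose continuity of the competing homomorphism: homomorphisms of
  C*-algebras are automatically contractive (\<open>cstar_hom_norm_le\<close>).
\<close>

section \<open>Completeness of the Hilbert space\<close>

lemma sum_coord_le_norm:
  "finite F \<Longrightarrow> (\<Sum>x\<in>F. (cmod (Rep_ell2 f x))\<^sup>2) \<le> (norm f)\<^sup>2"
  unfolding norm_ell2_sq by (rule finite_sum_le_infsum[OF ell2_summable]) simp_all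

lemma coord_le_norm: "cmod (Rep_ell2 f x) \<le> norm f"
  using sum_coord_le_norm[of "{x}" f] by (simp add: power2_le_iff_abs_le)

text \<open>Completeness is what makes a densely defined contractive homomorphism extend: the limit of a Cauchy
  sequence is taken coordinatewise, and the finite partial sums of squares control it uniformly.\<close>

instance ell2 :: (type) complete_space
proof
  fix X :: "nat \<Rightarrow> 'a ell2"
  assume X: "Cauchy X"
  have "Cauchy (\<lambda>n. Rep_ell2 (X n) x)" for x
  proof (rule metric_CauchyI)
    fix e :: real assume "e > 0"
    then obtain N where N: "\<forall>m\<ge>N. \<forall>n\<ge>N. dist (X m) (X n) < e"
      using X unfolding Cauchy_def by blast
    have "dist (Rep_ell2 (X m) x) (Rep_ell2 (X n) x) < e" if "m \<ge> N" "n \<ge> N" for m n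
      using coord_le_norm[of "X m - X n" x] N that
      by (force simp: dist_norm minus_ell2.rep_eq)
    then show "\<exists>N. \<forall>m\<ge>N. \<forall>n\<ge>N. dist (Rep_ell2 (X m) x) (Rep_ell2 (X n) x) < e" by blast
  qed
  then have "\<exists>l. (\<lambda>n. Rep_ell2 (X n) x) \<longlonglongrightarrow> l" for x
    using Cauchy_convergent convergent_def by blast
  then obtain L where L: "\<And>x. (\<lambda>n. Rep_ell2 (X n) x) \<longlonglongrightarrow> L x" by metis
  have tail: "\<exists>N. \<forall>n\<ge>N. \<forall>F. finite F \<longrightarrow> (\<Sum>x\<in>F. (cmod (Rep_ell2 (X n) x - L x))\<^sup>2) \<le> e\<^sup>2"
    if e: "e > 0" for e :: real
  proof -
    obtain N where N: "\<forall>m\<ge>N. \<forall>n\<ge>N. dist (X m) (X n) < e"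
      using X e unfolding Cauchy_def by blast
    have "(\<Sum>x\<in>F. (cmod (Rep_ell2 (X n) x - L x))\<^sup>2) \<le> e\<^sup>2" if n: "n \<ge> N" and F: "finite F" for n F
    proof (rule LIMSEQ_le_const2)
      show "(\<lambda>m. \<Sum>x\<in>F. (cmod (Rep_ell2 (X n) x - Rep_ell2 (X m) x))\<^sup>2)
          \<longlonglongrightarrow> (\<Sum>x\<in>F. (cmod (Rep_ell2 (X n) x - L x))\<^sup>2)"
        by (intro tendsto_intros L)
      have "(\<Sum>x\<in>F. (cmod (Rep_ell2 (X n) x - Rep_ell2 (X m) x))\<^sup>2) \<le> e\<^sup>2" if "m \<ge> N" for m
      proof -
        have "(\<Sum>x\<in>F. (cmod (Rep_ell2 (X n) x - Rep_ell2 (X m) x))\<^sup>2) \<le> (norm (X n - X m))\<^sup>2"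
          using sum_coord_le_norm[OF F, of "X n - X m"] by (simp add: minus_ell2.rep_eq)
        also have "\<dots> \<le> e\<^sup>2"
          using N n that by (intro power_mono) (auto simp: dist_norm less_imp_le)
        finally show ?thesis .
      qed
      then show "\<exists>N. \<forall>m\<ge>N. (\<Sum>x\<in>F. (cmod (Rep_ell2 (X n) x - Rep_ell2 (X m) x))\<^sup>2) \<le> e\<^sup>2" by blast
    qed
    then show ?thesis by blast
  qed
  obtain N where "\<forall>F. finite F \<longrightarrow> (\<Sum>x\<in>F. (cmod (Rep_ell2 (X N) x - L x))\<^sup>2) \<le> 1\<^sup>2"
    using tail[of 1] by auto
  then have "(\<lambda>x. Rep_ell2 (X N) x - L x) \<in> {f. (\<lambda>x. (cmod (f x))\<^sup>2) summable_on UNIV}"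
    by (intro ell2_memI(1)) blast
  then have "(\<lambda>x. (cmod (Rep_ell2 (X N) x - L x))\<^sup>2) summable_on UNIV" by simp
  from square_summable_diff[OF ell2_summable[of "X N" UNIV] this]
  have "(\<lambda>x. (cmod (L x))\<^sup>2) summable_on UNIV" by simp
  then have rep: "Rep_ell2 (Abs_ell2 L) = L" by (simp add: Abs_ell2_inverse)
  have "X \<longlonglongrightarrow> Abs_ell2 L"
  proof (rule metric_LIMSEQ_I)
    fix e :: real assume e: "e > 0"
    then obtain N where
      N: "\<forall>n\<ge>N. \<forall>F. finite F \<longrightarrow> (\<Sum>x\<in>F. (cmod (Rep_ell2 (X n) x - L x))\<^sup>2) \<le> (e/2)\<^sup>2"
      using tail[of "e/2"] by auto
    have "dist (X n) (Abs_ell2 L) < e" if "n \<ge> N" for n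
    proof -
      have "(norm (X n - Abs_ell2 L))\<^sup>2 \<le> (e/2)\<^sup>2"
        unfolding norm_ell2_sq minus_ell2.rep_eq rep
        by (rule ell2_memI(2)) (use N that in blast)
      then have "norm (X n - Abs_ell2 L) \<le> e/2" using power2_le_imp_le[of "norm (X n - Abs_ell2 L)" "e/2"] e by linarith
      then show ?thesis using e by (simp add: dist_norm)
    qed
    then show "\<exists>N. \<forall>n\<ge>N. dist (X n) (Abs_ell2 L) < e" by blast
  qed
  then show "convergent X" by (rule convergentI)
qed

instance ell2 :: (type) banach ..


section \<open>Calculus of operators\<close>

lemma bounded_linear_scaleC: "bounded_linear ((*\<^sub>C) c)"
  by (rule bounded_linear_intro[of _ "cmod c"])
     (simp_all add: scaleC_add_right scaleC_scaleR norm_scaleC)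

lemma bounded_linear_scale_op: "bounded_linear (scale_op c)"
proof (rule bounded_linear_intro)
  fix T :: "'a ell2 \<Rightarrow>\<^sub>L 'b ell2"
  show "norm (scale_op c T) \<le> norm T * cmod c"
  proof (rule norm_blinfun_bound)
    show "norm (scale_op c T f) \<le> norm T * cmod c * norm f" for f
      using mult_left_mono[OF norm_blinfun[of T f] norm_ge_zero[of c]]
      by (simp add: scale_op_apply norm_scaleC mult_ac)
  qed simp
qed (auto intro!: blinfun_eqI
      simp: scale_op_apply blinfun.add_left blinfun.scaleR_left scaleC_add_right scaleC_scaleR)

lemma clinear_op_add: "clinear_op S \<Longrightarrow> clinear_op T \<Longrightarrow> clinear_op (S + T)"
  and clinear_op_scale: "clinear_op T \<Longrightarrow> clinear_op (scale_op c T)"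
  and clinear_op_zero: "clinear_op 0"
  and clinear_op_compose: "clinear_op U \<Longrightarrow> clinear_op V \<Longrightarrow> clinear_op (U o\<^sub>L V)"
  by (simp_all add: clinear_op_def blinfun.add_left scaleC_add_right scale_op_apply
      scaleC_scaleC mult.commute)
    (auto intro!: ell2_eqI simp: scaleC.rep_eq zero_ell2.rep_eq)

lemma closed_clinear_op: "closed {T :: 'a ell2 \<Rightarrow>\<^sub>L 'b ell2. clinear_op T}"
proof -
  have "{T :: 'a ell2 \<Rightarrow>\<^sub>L 'b ell2. clinear_op T}
      = (\<Inter>c. \<Inter>f. {T. blinfun_apply T (c *\<^sub>C f) = c *\<^sub>C T f})"
    by (auto simp: clinear_op_def)
  moreover have "closed {T :: 'a ell2 \<Rightarrow>\<^sub>L 'b ell2. T (c *\<^sub>C f) = c *\<^sub>C T f}" for c f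
    by (intro closed_Collect_eq bounded_linear.continuous_on[OF bounded_linear_scaleC]
        continuous_intros)
  ultimately show ?thesis by (simp add: closed_INT)
qed

lemma scale_op_compose_left: "scale_op c S o\<^sub>L T = scale_op c (S o\<^sub>L T)"
  by (rule blinfun_eqI) (simp add: scale_op_apply)

lemma scale_op_compose_right: "clinear_op S \<Longrightarrow> S o\<^sub>L scale_op c T = scale_op c (S o\<^sub>L T)"
  by (rule blinfun_eqI) (simp add: scale_op_apply clinear_op_def)

lemma scale_op_minus_one: "S + scale_op (- 1) T = S - T"
  by (rule blinfun_eqI, rule ell2_eqI)
     (simp add: scale_op_apply blinfun.add_left blinfun.diff_left plus_ell2.rep_eq
      minus_ell2.rep_eq scaleC.rep_eq)

lemma tendsto_compose_op:
  fixes S :: "nat \<Rightarrow> 'b ell2 \<Rightarrow>\<^sub>L 'c ell2" and T :: "nat \<Rightarrow> 'a ell2 \<Rightarrow>\<^sub>L 'b ell2"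
  assumes "S \<longlonglongrightarrow> S'" "T \<longlonglongrightarrow> T'"
  shows "(\<lambda>n. S n o\<^sub>L T n) \<longlonglongrightarrow> (S' o\<^sub>L T')"
  by (rule bounded_bilinear.tendsto[OF bounded_bilinear_blinfun_compose assms])

lemma adj_eqI:
  assumes "clinear_op T" "\<And>f g. cinner (T f) g = cinner f (blinfun_apply S g)"
  shows "adj T = S"
  unfolding adj_def by (rule the1_equality[OF adj_ex1[OF assms(1)]]) (use assms(2) in blast)

lemma cinner_adj_left: "clinear_op T \<Longrightarrow> cinner (adj T f) g = cinner f (T g)"
  using cinner_adj[of T g f] cinner_commute[of "adj T f" g] cinner_commute[of f "T g"] by simp

lemma Rep_adj_ket:
  assumes "clinear_op T"
  shows "Rep_ell2 (adj T (ket y)) x = cnj (Rep_ell2 (T (ket x)) y)"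
  using cinner_adj_left[OF assms, of "ket y" "ket x"] cinner_commute[of "ket y" "T (ket x)"]
  by (simp add: cinner_ket_right)

lemma clinear_op_adj:
  assumes "clinear_op T"
  shows "clinear_op (adj T)"
  unfolding clinear_op_def
proof (intro allI ell2_eqI)
  fix c f x
  have "Rep_ell2 (adj T g) x = cinner g (T (ket x))" for g
    using cinner_adj_left[OF assms, of g "ket x"] by (simp add: cinner_ket_right)
  then show "Rep_ell2 (adj T (c *\<^sub>C f)) x = Rep_ell2 (c *\<^sub>C adj T f) x"
    by (simp add: cinner_scaleC_left scaleC.rep_eq)
qed

lemma adj_adj: "clinear_op T \<Longrightarrow> adj (adj T) = T"
  by (intro adj_eqI clinear_op_adj cinner_adj_left)

lemma adj_add: "clinear_op S \<Longrightarrow> clinear_op T \<Longrightarrow> adj (S + T) = adj S + adj T"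
  by (rule adj_eqI)
     (simp_all add: clinear_op_add blinfun.add_left cinner_add_left cinner_add_right cinner_adj)

lemma adj_scale: "clinear_op T \<Longrightarrow> adj (scale_op c T) = scale_op (cnj c) (adj T)"
  by (rule adj_eqI)
     (simp_all add: clinear_op_scale scale_op_apply cinner_scaleC_left cinner_scaleC_right
       cinner_adj)

lemma adj_compose: "clinear_op S \<Longrightarrow> clinear_op T \<Longrightarrow> adj (S o\<^sub>L T) = adj T o\<^sub>L adj S"
  by (rule adj_eqI) (simp_all add: clinear_op_compose cinner_adj)

lemma norm_adj_le:
  assumes "clinear_op T"
  shows "norm (adj T) \<le> norm T"
proof (rule norm_blinfun_bound)
  fix g
  have "(norm (adj T g))\<^sup>2 = Re (cinner (adj T g) (adj T g))"
    by (simp add: Re_cinner power2_norm_eq_inner)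
  also have "\<dots> = Re (cinner (T (adj T g)) g)" by (simp add: cinner_adj[OF assms])
  also have "\<dots> \<le> norm (T (adj T g)) * norm g"
    by (simp add: Re_cinner norm_cauchy_schwarz)
  also have "\<dots> \<le> norm T * norm (adj T g) * norm g"
    by (intro mult_right_mono norm_blinfun) simp
  finally have "norm (adj T g) * norm (adj T g) \<le> norm (adj T g) * (norm T * norm g)"
    by (simp add: power2_eq_square mult_ac)
  then show "norm (adj T g) \<le> norm T * norm g"
    by (cases "norm (adj T g) = 0") (auto simp: mult_le_cancel_left)
qed simp

lemma tendsto_adj:
  assumes "\<And>n. clinear_op (T n)" "clinear_op S" "T \<longlonglongrightarrow> S"
  shows "(\<lambda>n. adj (T n)) \<longlonglongrightarrow> adj S"
proof (rule Lim_transform_bound[of _ "\<lambda>n. T n - S", THEN LIM_zero_cancel])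
  have "adj (T n) - adj S = adj (T n - S)" for n
    using assms by (simp add: scale_op_minus_one[symmetric] adj_add adj_scale clinear_op_scale)
  moreover have "clinear_op (T n - S)" for n
    using assms by (simp add: scale_op_minus_one[symmetric] clinear_op_add clinear_op_scale)
  ultimately show "\<forall>\<^sub>F n in sequentially. norm (adj (T n) - adj S) \<le> norm (T n - S)"
    by (simp add: norm_adj_le)
  show "(\<lambda>n. T n - S) \<longlonglongrightarrow> 0" using assms(3) by (rule LIM_zero)
qed

lemma tensor_op_ket:
  assumes "clinear_op S" "clinear_op T"
  shows "(S \<otimes>\<^sub>o T) (ket (x, y)) = S (ket x) \<otimes>\<^sub>v T (ket y)"
  using tensor_op(2)[OF assms, of "ket x" "ket y"] by (simp add: tensor_vec_ket)

lemma tensor_op_compose: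
  assumes "clinear_op S" "clinear_op T" "clinear_op S'" "clinear_op T'"
  shows "(S \<otimes>\<^sub>o T) o\<^sub>L (S' \<otimes>\<^sub>o T') = (S o\<^sub>L S') \<otimes>\<^sub>o (T o\<^sub>L T')"
proof (rule clinear_op_eqI)
  fix z
  show "((S \<otimes>\<^sub>o T) o\<^sub>L (S' \<otimes>\<^sub>o T')) (ket z) = ((S o\<^sub>L S') \<otimes>\<^sub>o (T o\<^sub>L T')) (ket z)"
    using assms by (cases z) (simp add: tensor_op_ket clinear_op_compose tensor_op)
qed (use assms in \<open>simp_all add: tensor_op clinear_op_compose\<close>)

lemma adj_tensor_op:
  assumes "clinear_op S" "clinear_op T"
  shows "adj (S \<otimes>\<^sub>o T) = adj S \<otimes>\<^sub>o adj T"
proof (rule clinear_op_eqI)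
  fix z
  show "adj (S \<otimes>\<^sub>o T) (ket z) = (adj S \<otimes>\<^sub>o adj T) (ket z)"
  proof (rule ell2_eqI)
    fix w
    show "Rep_ell2 (adj (S \<otimes>\<^sub>o T) (ket z)) w = Rep_ell2 ((adj S \<otimes>\<^sub>o adj T) (ket z)) w"
      using assms
      by (cases z; cases w)
         (simp add: Rep_adj_ket tensor_op tensor_op_ket clinear_op_adj tensor_vec.rep_eq)
  qed
qed (use assms in \<open>simp_all add: tensor_op clinear_op_adj\<close>)

lemma tensor_op_scale_left:
  assumes "clinear_op S" "clinear_op T"
  shows "scale_op c S \<otimes>\<^sub>o T = scale_op c (S \<otimes>\<^sub>o T)"
proof (rule clinear_op_eqI)
  fix z
  show "(scale_op c S \<otimes>\<^sub>o T) (ket z) = scale_op c (S \<otimes>\<^sub>o T) (ket z)"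
    using assms
    by (cases z)
       (auto intro!: ell2_eqI simp: tensor_op_ket clinear_op_scale scale_op_apply
         tensor_vec.rep_eq scaleC.rep_eq)
qed (use assms in \<open>simp_all add: tensor_op clinear_op_scale\<close>)


section \<open>C*-subalgebras and their homomorphisms\<close>

lemma cstar_subalgebraD:
  assumes "cstar_subalgebra A"
  shows "\<And>T. T \<in> A \<Longrightarrow> clinear_op T" "0 \<in> A"
    "\<And>S T. S \<in> A \<Longrightarrow> T \<in> A \<Longrightarrow> S + T \<in> A"
    "\<And>S T. S \<in> A \<Longrightarrow> T \<in> A \<Longrightarrow> S o\<^sub>L T \<in> A"
    "\<And>c T. T \<in> A \<Longrightarrow> scale_op c T \<in> A"
    "\<And>T. T \<in> A \<Longrightarrow> adj T \<in> A" "closed A"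
  using assms unfolding cstar_subalgebra_def by auto

lemma cstar_homD:
  assumes "cstar_hom A B \<Phi>"
  shows "\<And>T. T \<in> A \<Longrightarrow> \<Phi> T \<in> B"
    "\<And>S T. S \<in> A \<Longrightarrow> T \<in> A \<Longrightarrow> \<Phi> (S + T) = \<Phi> S + \<Phi> T"
    "\<And>S T. S \<in> A \<Longrightarrow> T \<in> A \<Longrightarrow> \<Phi> (S o\<^sub>L T) = \<Phi> S o\<^sub>L \<Phi> T"
    "\<And>c T. T \<in> A \<Longrightarrow> \<Phi> (scale_op c T) = scale_op c (\<Phi> T)"
    "\<And>T. T \<in> A \<Longrightarrow> \<Phi> (adj T) = adj (\<Phi> T)"
  using assms unfolding cstar_hom_def by auto

lemma cstar_subalgebra_clinear: "cstar_subalgebra {T. clinear_op T}"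
  unfolding cstar_subalgebra_def
  by (simp add: clinear_op_zero clinear_op_add clinear_op_compose clinear_op_scale clinear_op_adj
      closed_clinear_op)

lemma cstar_generated_least: "cstar_subalgebra A \<Longrightarrow> G \<subseteq> A \<Longrightarrow> cstar_generated G \<subseteq> A"
  unfolding cstar_generated_def by blast

lemma cstar_generated_superset: "G \<subseteq> cstar_generated G"
  unfolding cstar_generated_def by blast

lemma cstar_subalgebra_generated:
  assumes "\<And>T. T \<in> G \<Longrightarrow> clinear_op T"
  shows "cstar_subalgebra (cstar_generated G)"
proof -
  have "cstar_generated G \<subseteq> {T. clinear_op T}"
    by (rule cstar_generated_least[OF cstar_subalgebra_clinear]) (use assms in auto)
  moreover have "closed (cstar_generated G)"
    unfolding cstar_generated_def by (rule closed_Inter) (auto simp: cstar_subalgebra_def)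
  ultimately show ?thesis
    unfolding cstar_subalgebra_def by (auto simp: cstar_generated_def cstar_subalgebra_def)
qed

lemma scale_op_of_real: "scale_op (of_real r) T = r *\<^sub>R T"
  by (rule blinfun_eqI, rule ell2_eqI)
     (simp add: scale_op_apply blinfun.scaleR_left scaleC.rep_eq scaleR_ell2.rep_eq
      scaleR_conv_of_real)

lemma inner_adj: "clinear_op T \<Longrightarrow> inner (T f) g = inner f (adj T g)"
  using cinner_adj[of T f g] by (simp add: Re_cinner[symmetric])

text \<open>The value of the adjoint is unspecified outside the complex-linear operators, so its continuity
  is available only among them.\<close>

lemma closed_selfadjoint:
  assumes "closed A" "\<And>T. T \<in> A \<Longrightarrow> clinear_op T"
  shows "closed {T \<in> A. adj T = T}"
proof (rule closed_sequential_limits[THEN iffD2, rule_format])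
  fix X l assume X: "(\<forall>n. X n \<in> {T \<in> A. adj T = T}) \<and> X \<longlonglongrightarrow> l"
  then have l: "l \<in> A" using assms(1) closed_sequentially by blast
  have "(\<lambda>n. adj (X n)) \<longlonglongrightarrow> adj l"
    by (rule tendsto_adj) (use X l assms in auto)
  with X have "X \<longlonglongrightarrow> adj l" by simp
  with X l show "l \<in> {T \<in> A. adj T = T}" using LIMSEQ_unique by blast
qed

text \<open>The equation says \<open>(1 - y)\<^sup>2 = 1 - x\<close>, so this is the square root of \<open>1 - x\<close>
  inside a possibly non-unital algebra. On the ball of radius \<open>\<parallel>x\<parallel> < 1\<close> the map
  \<open>y \<mapsto> (x + y\<^sup>2) / 2\<close> is a contraction with constant \<open>\<parallel>x\<parallel>\<close>, and it preserves self-adjointness,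
  so Banach's fixed point theorem replaces the functional calculus.\<close>

lemma selfadjoint_root:
  assumes A: "cstar_subalgebra A" and x: "x \<in> A" "adj x = x" "norm x < 1"
  obtains y where "y \<in> A" "adj y = y" "y + y = x + (y o\<^sub>L y)"
proof -
  note A' = cstar_subalgebraD[OF A]
  define r where "r = norm x"
  define S where "S = {y \<in> A. adj y = y} \<inter> cball 0 r"
  define G where "G y = scale_op (1/2) (x + (y o\<^sub>L y))" for y
  have G_half: "G y = (1/2) *\<^sub>R (x + (y o\<^sub>L y))" for y
    using scale_op_of_real[of "1/2" "x + (y o\<^sub>L y)"] by (simp add: G_def)
  have r: "0 \<le> r" "r < 1" using x by (simp_all add: r_def)
  have S: "y \<in> S \<longleftrightarrow> y \<in> A \<and> adj y = y \<and> norm y \<le> r" for y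
    by (auto simp: S_def)
  have "\<exists>!y\<in>S. G y = y"
  proof (rule Banach_fix[OF _ _ r])
    have "closed S" unfolding S_def
      by (intro closed_Int closed_selfadjoint closed_cball A')
    then show "complete S" by (simp add: complete_eq_closed)
    show "S \<noteq> {}" using x S by (force simp: r_def)
    show "G ` S \<subseteq> S"
    proof safe
      fix y assume y: "y \<in> S"
      then have yA: "y \<in> A" "clinear_op y" "adj y = y" and yr: "norm y \<le> r"
        using A' S by auto
      have "norm (y o\<^sub>L y) \<le> norm y * norm y" by (rule norm_blinfun_compose)
      also have "\<dots> \<le> r * 1" using yr r by (intro mult_mono) auto
      finally have "norm (x + (y o\<^sub>L y)) \<le> r + r"
        using norm_triangle_ineq[of x "y o\<^sub>L y"] by (simp add: r_def)
      then have "norm (G y) \<le> r" by (simp add: G_half)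
      moreover have "adj (G y) = G y"
        using x yA A' by (simp add: G_def adj_scale adj_add adj_compose clinear_op_add
            clinear_op_compose)
      moreover have "G y \<in> A" using x yA A' by (simp add: G_def)
      ultimately show "G y \<in> S" using S by simp
    qed
    fix y z assume yz: "y \<in> S" "z \<in> S"
    have "G y - G z = (1/2) *\<^sub>R ((y o\<^sub>L (y - z)) + ((y - z) o\<^sub>L z))"
      by (rule blinfun_eqI)
         (simp add: G_half blinfun.add_left blinfun.diff_left blinfun.diff_right
          blinfun.scaleR_left algebra_simps)
    moreover have "norm ((y o\<^sub>L (y - z)) + ((y - z) o\<^sub>L z)) \<le> r * norm (y - z) + norm (y - z) * r"
    proof (rule order_trans[OF norm_triangle_ineq], rule add_mono)
      show "norm (y o\<^sub>L (y - z)) \<le> r * norm (y - z)"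
        using yz S by (intro order_trans[OF norm_blinfun_compose] mult_right_mono) auto
      show "norm ((y - z) o\<^sub>L z) \<le> norm (y - z) * r"
        using yz S by (intro order_trans[OF norm_blinfun_compose] mult_left_mono) auto
    qed
    ultimately show "dist (G y) (G z) \<le> r * dist y z"
      by (simp add: dist_norm)
  qed
  then obtain y where y: "y \<in> S" "G y = y" by blast
  have "y + y = 2 *\<^sub>R G y" by (simp add: y(2) scaleR_2)
  also have "\<dots> = x + (y o\<^sub>L y)" by (simp add: G_half)
  finally show thesis using that y S by blast
qed

text \<open>Homomorphisms of C*-algebras are contractive. If \<open>\<parallel>T\<parallel> < 1\<close>, write \<open>1 - T\<^sup>*T = (1 - y)\<^sup>2\<close> with
  \<open>y\<close> self-adjoint in the algebra. Then \<open>\<Phi>(T)\<^sup>*\<Phi>(T) = 1 - (1 - \<Phi>(y))\<^sup>2 \<le> 1\<close>, and scaling gives the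
  general case. This is what makes a homomorphism determined by its values on generators.\<close>

lemma cstar_hom_norm_le:
  assumes A: "cstar_subalgebra A" and \<Phi>: "cstar_hom A B \<Phi>"
    and B: "\<And>S. S \<in> B \<Longrightarrow> clinear_op S" and T: "T \<in> A"
  shows "norm (\<Phi> T) \<le> norm T"
proof -
  note A' = cstar_subalgebraD[OF A] and \<Phi>' = cstar_homD[OF \<Phi>]
  \<comment> \<open>The identity \<open>\<parallel>\<Phi>(T) f\<parallel>\<^sup>2 = \<parallel>f\<parallel>\<^sup>2 - \<parallel>f - \<Phi>(y) f\<parallel>\<^sup>2\<close> carries this step.\<close>
  have unit: "norm (\<Phi> T) \<le> 1" if T: "T \<in> A" and lt: "norm T < 1" for T
  proof (rule norm_blinfun_bound)
    fix f
    define x where "x = adj T o\<^sub>L T"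
    have cT: "clinear_op T" "clinear_op (adj T)" using A' T by auto
    have x: "x \<in> A" "adj x = x"
      using A' T cT by (simp_all add: x_def adj_compose adj_adj)
    have "norm x \<le> norm (adj T) * norm T" unfolding x_def by (rule norm_blinfun_compose)
    also have "\<dots> \<le> norm T * norm T" by (intro mult_right_mono norm_adj_le cT) simp
    also have "\<dots> < 1" using lt mult_strict_mono[of "norm T" 1 "norm T" 1] by simp
    finally obtain y where y: "y \<in> A" "adj y = y" "y + y = x + (y o\<^sub>L y)"
      using selfadjoint_root[OF A x] by blast
    define W where "W = \<Phi> T"
    define Z where "Z = \<Phi> y"
    have cW: "clinear_op W" and cZ: "clinear_op Z" using B \<Phi>' T y by (auto simp: W_def Z_def)
    have adjZ: "adj Z = Z" using \<Phi>'(5)[OF y(1)] y(2) by (simp add: Z_def)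
    have "\<Phi> x = adj W o\<^sub>L W" using \<Phi>' A' T by (simp add: x_def W_def)
    moreover have "Z + Z = \<Phi> x + (Z o\<^sub>L Z)"
      using arg_cong[OF y(3), of \<Phi>] x y(1) A' \<Phi>' by (simp add: Z_def)
    ultimately have "(Z + Z) f = (adj W o\<^sub>L W) f + (Z o\<^sub>L Z) f"
      by (simp add: blinfun.add_left)
    then have e: "adj W (W f) = Z f + Z f - Z (Z f)"
      by (simp add: blinfun.add_left)
    have "(norm (W f))\<^sup>2 = inner f (adj W (W f))"
      by (simp add: power2_norm_eq_inner inner_adj cW)
    also have "\<dots> = 2 * inner f (Z f) - inner (Z f) (Z f)"
      by (simp add: e inner_add_right inner_diff_right inner_adj[OF cZ] adjZ)
    also have "\<dots> = (norm f)\<^sup>2 - (norm (f - Z f))\<^sup>2"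
      by (simp add: power2_norm_eq_inner inner_diff_left inner_diff_right inner_commute)
    also have "\<dots> \<le> (norm f)\<^sup>2" by simp
    finally show "norm (\<Phi> T f) \<le> 1 * norm f" by (simp add: W_def)
  qed simp
  show ?thesis
  proof (rule field_le_epsilon)
    fix e :: real assume e: "e > 0"
    define s where "s = norm T + e"
    have s: "s > 0" using e by (simp add: s_def add_nonneg_pos)
    have "norm (scale_op (of_real (1/s)) T) < 1"
      using s e by (simp only: scale_op_of_real) (simp add: s_def)
    moreover have "scale_op (of_real (1/s)) T \<in> A" using A' T by blast
    ultimately have "norm (\<Phi> (scale_op (of_real (1/s)) T)) \<le> 1" using unit by blast
    also have "\<Phi> (scale_op (of_real (1/s)) T) = (1/s) *\<^sub>R \<Phi> T"
      using \<Phi>'(4)[OF T, of "of_real (1/s)"] by (simp only: scale_op_of_real)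
    finally show "norm (\<Phi> T) \<le> norm T + e"
      using s by (simp add: s_def[symmetric])
  qed
qed

text \<open>By contractivity the set where the two homomorphisms agree is closed, hence a C*-subalgebra.\<close>

lemma cstar_hom_eqI:
  assumes G: "\<And>T. T \<in> G \<Longrightarrow> clinear_op T" and B: "\<And>S. S \<in> B \<Longrightarrow> clinear_op S"
    and \<Phi>: "cstar_hom (cstar_generated G) B \<Phi>" and \<Psi>: "cstar_hom (cstar_generated G) B \<Psi>"
    and eq: "\<And>T. T \<in> G \<Longrightarrow> \<Phi> T = \<Psi> T" and T: "T \<in> cstar_generated G"
  shows "\<Phi> T = \<Psi> T"
proof -
  let ?A = "cstar_generated G"
  note sub = cstar_subalgebra_generated[of G, OF G]
  note A = cstar_subalgebraD[OF sub]
  note P = cstar_homD[OF \<Phi>] and Q = cstar_homD[OF \<Psi>]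
  have lim: "(\<lambda>n. F (X n)) \<longlonglongrightarrow> F l"
    if F: "cstar_hom ?A B F" and X: "\<And>n. X n \<in> ?A" "l \<in> ?A" "X \<longlonglongrightarrow> l" for F X l
  proof (rule Lim_transform_bound[of _ "\<lambda>n. X n - l", THEN LIM_zero_cancel])
    note F' = cstar_homD[OF F]
    have "F (X n) - F l = F (X n - l)" for n
      using F' A X by (simp add: scale_op_minus_one[symmetric])
    moreover have "X n - l \<in> ?A" for n
      using A X by (simp add: scale_op_minus_one[symmetric])
    ultimately show "\<forall>\<^sub>F n in sequentially. norm (F (X n) - F l) \<le> norm (X n - l)"
      using cstar_hom_norm_le[OF sub F B] by simp
    show "(\<lambda>n. X n - l) \<longlonglongrightarrow> 0" using X(3) by (rule LIM_zero)
  qed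
  define E where "E = {T \<in> ?A. \<Phi> T = \<Psi> T}"
  have "closed E"
  proof (rule closed_sequential_limits[THEN iffD2, rule_format])
    fix X l assume X: "(\<forall>n. X n \<in> E) \<and> X \<longlonglongrightarrow> l"
    then have XA: "\<And>n. X n \<in> ?A" and XE: "\<And>n. \<Phi> (X n) = \<Psi> (X n)" by (auto simp: E_def)
    with X A(7) have l: "l \<in> ?A" using closed_sequentially by blast
    have "(\<lambda>n. \<Phi> (X n)) \<longlonglongrightarrow> \<Phi> l" "(\<lambda>n. \<Psi> (X n)) \<longlonglongrightarrow> \<Psi> l"
      using lim[OF \<Phi> XA l] lim[OF \<Psi> XA l] X by auto
    then have "\<Phi> l = \<Psi> l" using XE LIMSEQ_unique by auto
    with l show "l \<in> E" by (simp add: E_def)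
  qed
  moreover have "0 \<in> E"
  proof -
    have "\<Phi> 0 = 0" "\<Psi> 0 = 0" using P(2)[OF A(2) A(2)] Q(2)[OF A(2) A(2)] by simp_all
    with A(2) show ?thesis by (simp add: E_def)
  qed
  ultimately have "cstar_subalgebra E"
    unfolding cstar_subalgebra_def using A P Q by (auto simp: E_def)
  then have "?A \<subseteq> E"
    by (rule cstar_generated_least) (use eq cstar_generated_superset[of G] in \<open>auto simp: E_def\<close>)
  with T show ?thesis by (auto simp: E_def)
qed

text \<open>A homomorphism is extended from a dense *-subalgebra by closing its graph \<open>R\<close>. The norm inequality
  survives the closure; it makes the closed graph single-valued and, because the target is complete,
  makes its domain closed. The domain is therefore a C*-subalgebra containing the generators.\<close>

lemma cstar_hom_extension:
  fixes R :: "(('a ell2 \<Rightarrow>\<^sub>L 'a ell2) \<times> ('b ell2 \<Rightarrow>\<^sub>L 'b ell2)) set"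
  assumes clin: "\<And>T T'. (T, T') \<in> R \<Longrightarrow> clinear_op T \<and> clinear_op T'"
    and add: "\<And>S S' T T'. (S, S') \<in> R \<Longrightarrow> (T, T') \<in> R \<Longrightarrow> (S + T, S' + T') \<in> R"
    and comp: "\<And>S S' T T'. (S, S') \<in> R \<Longrightarrow> (T, T') \<in> R \<Longrightarrow> (S o\<^sub>L T, S' o\<^sub>L T') \<in> R"
    and scale: "\<And>c T T'. (T, T') \<in> R \<Longrightarrow> (scale_op c T, scale_op c T') \<in> R"
    and star: "\<And>T T'. (T, T') \<in> R \<Longrightarrow> (adj T, adj T') \<in> R"
    and norm: "\<And>T T'. (T, T') \<in> R \<Longrightarrow> norm T' \<le> norm T"
    and G: "G \<noteq> {}" "G \<subseteq> fst ` R" and B: "closed B" "snd ` R \<subseteq> B"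
  shows "\<exists>\<Delta>. cstar_hom (cstar_generated G) B \<Delta> \<and> (\<forall>(T, T')\<in>R. \<Delta> T = T')"
proof -
  define \<Gamma> where "\<Gamma> = closure R"
  have seq: "\<exists>t t'. (\<forall>n. (t n, t' n) \<in> R) \<and> t \<longlonglongrightarrow> T \<and> t' \<longlonglongrightarrow> T'" if "(T, T') \<in> \<Gamma>" for T T'
  proof -
    obtain z where z: "\<forall>n. z n \<in> R" "z \<longlonglongrightarrow> (T, T')"
      using \<open>(T, T') \<in> \<Gamma>\<close> unfolding \<Gamma>_def closure_sequential by blast
    have "(\<lambda>n. fst (z n)) \<longlonglongrightarrow> T" "(\<lambda>n. snd (z n)) \<longlonglongrightarrow> T'"
      using tendsto_fst[OF z(2)] tendsto_snd[OF z(2)] by simp_all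
    with z(1) show ?thesis
      by (intro exI[of _ "\<lambda>n. fst (z n)"] exI[of _ "\<lambda>n. snd (z n)"]) simp
  qed
  have lim: "(T, T') \<in> \<Gamma>" if "\<And>n. (t n, t' n) \<in> R" "t \<longlonglongrightarrow> T" "t' \<longlonglongrightarrow> T'" for t t' T T'
    unfolding \<Gamma>_def closure_sequential
    using that by (intro exI[of _ "\<lambda>n. (t n, t' n)"]) (auto intro: tendsto_Pair)
  have clin\<Gamma>: "clinear_op T" "clinear_op T'" if m: "(T, T') \<in> \<Gamma>" for T T'
  proof -
    obtain t t' where t: "\<forall>n. (t n, t' n) \<in> R" "t \<longlonglongrightarrow> T" "t' \<longlonglongrightarrow> T'" using seq[OF m] by blast
    then show "clinear_op T" "clinear_op T'"
      using closed_sequentially[OF closed_clinear_op] clin by (metis mem_Collect_eq)+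
  qed
  have norm\<Gamma>: "norm T' \<le> norm T" if m: "(T, T') \<in> \<Gamma>" for T T'
  proof -
    obtain t t' where t: "\<forall>n. (t n, t' n) \<in> R" "t \<longlonglongrightarrow> T" "t' \<longlonglongrightarrow> T'" using seq[OF m] by blast
    show ?thesis
      by (rule LIMSEQ_le[OF tendsto_norm[OF t(3)] tendsto_norm[OF t(2)]]) (use t norm in blast)
  qed
  have add\<Gamma>: "(S + T, S' + T') \<in> \<Gamma>" and comp\<Gamma>: "(S o\<^sub>L T, S' o\<^sub>L T') \<in> \<Gamma>"
    if m: "(S, S') \<in> \<Gamma>" "(T, T') \<in> \<Gamma>" for S S' T T'
  proof -
    obtain s s' where s: "\<forall>n. (s n, s' n) \<in> R" "s \<longlonglongrightarrow> S" "s' \<longlonglongrightarrow> S'" using seq[OF m(1)] by blast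
    obtain t t' where t: "\<forall>n. (t n, t' n) \<in> R" "t \<longlonglongrightarrow> T" "t' \<longlonglongrightarrow> T'" using seq[OF m(2)] by blast
    show "(S + T, S' + T') \<in> \<Gamma>"
      by (rule lim[OF add tendsto_add[OF s(2) t(2)] tendsto_add[OF s(3) t(3)]]) (use s t in auto)
    show "(S o\<^sub>L T, S' o\<^sub>L T') \<in> \<Gamma>"
      by (rule lim[OF comp tendsto_compose_op[OF s(2) t(2)] tendsto_compose_op[OF s(3) t(3)]])
         (use s t in auto)
  qed
  have scale\<Gamma>: "(scale_op c T, scale_op c T') \<in> \<Gamma>" and star\<Gamma>: "(adj T, adj T') \<in> \<Gamma>"
    if m: "(T, T') \<in> \<Gamma>" for c T T'
  proof -
    obtain t t' where t: "\<forall>n. (t n, t' n) \<in> R" "t \<longlonglongrightarrow> T" "t' \<longlonglongrightarrow> T'" using seq[OF m] by blast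
    note sc = bounded_linear.tendsto[OF bounded_linear_scale_op]
    show "(scale_op c T, scale_op c T') \<in> \<Gamma>"
      by (rule lim[OF scale sc[OF t(2)] sc[OF t(3)]]) (use t in auto)
    show "(adj T, adj T') \<in> \<Gamma>"
      by (rule lim[OF star tendsto_adj[OF _ _ t(2)] tendsto_adj[OF _ _ t(3)]])
         (use t clin clin\<Gamma>[OF m] in blast)+
  qed
  have diff\<Gamma>: "(S - T, S' - T') \<in> \<Gamma>" if "(S, S') \<in> \<Gamma>" "(T, T') \<in> \<Gamma>" for S S' T T'
    using add\<Gamma>[OF that(1) scale\<Gamma>[OF that(2), of "- 1"]] by (simp only: scale_op_minus_one)
  have uniq: "S' = T'" if "(T, S') \<in> \<Gamma>" "(T, T') \<in> \<Gamma>" for T S' T'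
    using norm\<Gamma>[OF diff\<Gamma>[OF that]] by simp
  have sub: "cstar_subalgebra (fst ` \<Gamma>)"
  proof -
    have "closed (fst ` \<Gamma>)"
    proof (rule closed_sequential_limits[THEN iffD2, rule_format])
      fix t T assume t: "(\<forall>n. t n \<in> fst ` \<Gamma>) \<and> t \<longlonglongrightarrow> T"
      then have "\<forall>n. \<exists>t'. (t n, t') \<in> \<Gamma>" by force
      then obtain t' where t': "\<And>n. (t n, t' n) \<in> \<Gamma>" by metis
      have "Cauchy t'"
      proof (rule metric_CauchyI)
        fix e :: real assume e: "e > 0"
        have "Cauchy t" using t LIMSEQ_imp_Cauchy by blast
        then obtain N where N: "\<forall>m\<ge>N. \<forall>n\<ge>N. dist (t m) (t n) < e"
          using e unfolding Cauchy_def by blast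
        have "dist (t' m) (t' n) \<le> dist (t m) (t n)" for m n
          unfolding dist_norm by (rule norm\<Gamma>[OF diff\<Gamma>[OF t' t']])
        then show "\<exists>N. \<forall>m\<ge>N. \<forall>n\<ge>N. dist (t' m) (t' n) < e"
          using N le_less_trans by blast
      qed
      then obtain T' where T': "t' \<longlonglongrightarrow> T'" using Cauchy_convergent convergent_def by blast
      have "(\<lambda>n. (t n, t' n)) \<longlonglongrightarrow> (T, T')" using t T' by (auto intro: tendsto_Pair)
      moreover have "closed \<Gamma>" by (simp add: \<Gamma>_def)
      ultimately have "(T, T') \<in> \<Gamma>"
        by (rule closed_sequentially[rotated 2]) (rule t')
      then show "T \<in> fst ` \<Gamma>" by force
    qed
    moreover have "0 \<in> fst ` \<Gamma>"
    proof -
      obtain T T' where "(T, T') \<in> R" using G by (metis all_not_in_conv image_iff prod.collapse subsetD)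
      then have "(T, T') \<in> \<Gamma>" using closure_subset by (auto simp: \<Gamma>_def)
      from diff\<Gamma>[OF this this] show ?thesis by force
    qed
    moreover have "S + T \<in> fst ` \<Gamma> \<and> S o\<^sub>L T \<in> fst ` \<Gamma>"
      if ST: "S \<in> fst ` \<Gamma>" "T \<in> fst ` \<Gamma>" for S T
    proof -
      obtain S' T' where "(S, S') \<in> \<Gamma>" "(T, T') \<in> \<Gamma>" using ST by auto
      from add\<Gamma>[OF this] comp\<Gamma>[OF this] show ?thesis by (metis fst_conv imageI)
    qed
    moreover have "clinear_op T \<and> scale_op c T \<in> fst ` \<Gamma> \<and> adj T \<in> fst ` \<Gamma>"
      if T: "T \<in> fst ` \<Gamma>" for c T
    proof -
      obtain T' where "(T, T') \<in> \<Gamma>" using T by auto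
      from clin\<Gamma>(1)[OF this] scale\<Gamma>[OF this] star\<Gamma>[OF this]
      show ?thesis by (metis fst_conv imageI)
    qed
    ultimately show ?thesis unfolding cstar_subalgebra_def by simp
  qed
  have R\<Gamma>: "R \<subseteq> \<Gamma>" unfolding \<Gamma>_def by (rule closure_subset)
  have gen: "cstar_generated G \<subseteq> fst ` \<Gamma>"
    by (rule cstar_generated_least[OF sub]) (use G R\<Gamma> in blast)
  have range: "T' \<in> B" if m: "(T, T') \<in> \<Gamma>" for T T'
  proof -
    obtain t t' where t: "\<forall>n. (t n, t' n) \<in> R" "t' \<longlonglongrightarrow> T'" using seq[OF m] by blast
    then have "\<forall>n. t' n \<in> B" using B(2) by force
    with t(2) B(1) show ?thesis using closed_sequentially by blast
  qed
  define \<Delta> where "\<Delta> T = (THE T'. (T, T') \<in> \<Gamma>)" for T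
  have \<Delta>: "\<Delta> T = T'" if "(T, T') \<in> \<Gamma>" for T T'
    unfolding \<Delta>_def by (rule the_equality) (use that uniq in blast)+
  have graph: "(T, \<Delta> T) \<in> \<Gamma>" if "T \<in> cstar_generated G" for T
    using \<Delta> gen that by fastforce
  have "cstar_hom (cstar_generated G) B \<Delta>"
    unfolding cstar_hom_def
    by (intro conjI ballI allI range[OF graph] \<Delta> add\<Gamma> comp\<Gamma> scale\<Gamma> star\<Gamma> graph)
  moreover have "\<forall>(T, T')\<in>R. \<Delta> T = T'" using \<Delta> R\<Gamma> by auto
  ultimately show ?thesis by blast
qed

lemma closed_min_tensor: "closed (A \<otimes>\<^sub>m\<^sub>i\<^sub>n B)"
  unfolding min_tensor_def by simp

lemma min_tensor_clinear:
  assumes "\<And>T. T \<in> A \<Longrightarrow> clinear_op T" "\<And>T. T \<in> B \<Longrightarrow> clinear_op T" "R \<in> A \<otimes>\<^sub>m\<^sub>i\<^sub>n B"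
  shows "clinear_op R"
proof -
  have "clinear_op (\<Sum>i<n. T i \<otimes>\<^sub>o S i)" if "\<forall>i<n. T i \<in> A" "\<forall>i<n. S i \<in> B" for n :: nat and T S
    using that by (induction n) (simp_all add: clinear_op_zero clinear_op_add tensor_op assms)
  then have "A \<otimes>\<^sub>m\<^sub>i\<^sub>n B \<subseteq> {R. clinear_op R}"
    unfolding min_tensor_def by (intro closure_minimal closed_clinear_op) auto
  with assms(3) show ?thesis by blast
qed

text \<open>The algebraic tensor product, of which the minimal tensor product is the closure.\<close>

definition tensor_sums ::
  "('a ell2 \<Rightarrow>\<^sub>L 'a ell2) set \<Rightarrow> ('b ell2 \<Rightarrow>\<^sub>L 'b ell2) set \<Rightarrow>
    (('a \<times> 'b) ell2 \<Rightarrow>\<^sub>L ('a \<times> 'b) ell2) set" where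
  "tensor_sums A B =
     {\<Sum>i<n. T i \<otimes>\<^sub>o S i | (n :: nat) T S. (\<forall>i<n. T i \<in> A) \<and> (\<forall>i<n. S i \<in> B)}"

lemma tensor_sums_subset_min_tensor: "tensor_sums A B \<subseteq> A \<otimes>\<^sub>m\<^sub>i\<^sub>n B"
  unfolding min_tensor_def tensor_sums_def by (rule closure_subset)

lemma tensor_sums_single: "T \<in> A \<Longrightarrow> S \<in> B \<Longrightarrow> T \<otimes>\<^sub>o S \<in> tensor_sums A B"
  unfolding tensor_sums_def
  by (rule CollectI, rule exI[of _ 1], rule exI[of _ "\<lambda>_. T"], rule exI[of _ "\<lambda>_. S"]) simp

lemma tensor_sums_add:
  assumes "P \<in> tensor_sums A B" "Q \<in> tensor_sums A B"
  shows "P + Q \<in> tensor_sums A B"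
proof -
  obtain n :: nat and T S where P: "P = (\<Sum>i<n. T i \<otimes>\<^sub>o S i)" "\<forall>i<n. T i \<in> A" "\<forall>i<n. S i \<in> B"
    using assms(1) unfolding tensor_sums_def by auto
  obtain m :: nat and T' S' where Q: "Q = (\<Sum>i<m. T' i \<otimes>\<^sub>o S' i)" "\<forall>i<m. T' i \<in> A" "\<forall>i<m. S' i \<in> B"
    using assms(2) unfolding tensor_sums_def by auto
  define T'' where "T'' i = (if i < n then T i else T' (i - n))" for i
  define S'' where "S'' i = (if i < n then S i else S' (i - n))" for i
  have "(\<Sum>i<n + k. T'' i \<otimes>\<^sub>o S'' i) = P + (\<Sum>i<k. T' i \<otimes>\<^sub>o S' i)" for k
    by (induction k) (simp_all add: P(1) T''_def S''_def add.assoc)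
  then have "P + Q = (\<Sum>i<n + m. T'' i \<otimes>\<^sub>o S'' i)" by (simp add: Q(1))
  moreover have "\<forall>i<n + m. T'' i \<in> A" "\<forall>i<n + m. S'' i \<in> B"
    using P Q by (auto simp: T''_def S''_def)
  ultimately show ?thesis unfolding tensor_sums_def by blast
qed

lemma tensor_sums_scale:
  assumes "cstar_subalgebra A" "cstar_subalgebra B" "P \<in> tensor_sums A B"
  shows "scale_op c P \<in> tensor_sums A B"
proof -
  obtain n :: nat and T S where P: "P = (\<Sum>i<n. T i \<otimes>\<^sub>o S i)" "\<forall>i<n. T i \<in> A" "\<forall>i<n. S i \<in> B"
    using assms(3) unfolding tensor_sums_def by auto
  have "scale_op c P = (\<Sum>i<n. scale_op c (T i \<otimes>\<^sub>o S i))"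
    unfolding P(1) by (rule linear_sum[OF bounded_linear.linear[OF bounded_linear_scale_op]])
  also have "\<dots> = (\<Sum>i<n. scale_op c (T i) \<otimes>\<^sub>o S i)"
    using P cstar_subalgebraD(1)[OF assms(1)] cstar_subalgebraD(1)[OF assms(2)]
    by (intro sum.cong) (simp_all add: tensor_op_scale_left)
  finally show ?thesis
    unfolding tensor_sums_def using P cstar_subalgebraD(5)[OF assms(1)]
    by (intro CollectI exI[of _ n] exI[of _ "\<lambda>i. scale_op c (T i)"] exI[of _ S]) simp
qed


section \<open>Partial translations of a left Ore monoid\<close>

lemma left_Ore_cancellative: "left_Ore TYPE('p::monoid_mult) \<Longrightarrow> cancellative TYPE('p)"
  by (simp add: left_Ore_def)

lemma left_cancel: "cancellative TYPE('p::monoid_mult) \<Longrightarrow> (a::'p) * b = a * c \<longleftrightarrow> b = c"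
  and right_cancel: "cancellative TYPE('p::monoid_mult) \<Longrightarrow> (b::'p) * a = c * a \<longleftrightarrow> b = c"
  unfolding cancellative_def by blast+

text \<open>The Ore condition in the form in which it is used: elements have common left multiples, which makes
  left fractions \<open>a\<^sup>-\<^sup>1 b\<close> composable although the enveloping group is never constructed.\<close>

lemma common_left_multiple:
  assumes "left_Ore TYPE('p::monoid_mult)"
  obtains c d where "c * (a::'p) = d * b"
proof -
  have "left_ideal (range (\<lambda>c. c * x))" for x :: 'p
    unfolding left_ideal_def by (auto simp: mult.assoc[symmetric])
  then have "range (\<lambda>c. c * a) \<inter> range (\<lambda>c. c * b) \<noteq> {}"
    using assms unfolding left_Ore_def by blast
  then show thesis using that by auto
qed

text \<open>The operator \<open>T\<close> acts on basis vectors as left multiplication by the fraction \<open>a\<^sup>-\<^sup>1 b\<close>, restricted to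
  the constructible ideal \<open>X\<close>.\<close>

definition partial_translation ::
  "'p::monoid_mult set \<Rightarrow> 'p \<Rightarrow> 'p \<Rightarrow> ('p ell2 \<Rightarrow>\<^sub>L 'p ell2) \<Rightarrow> bool" where
  "partial_translation X a b T \<longleftrightarrow> X \<in> constructible \<and> clinear_op T \<and>
     (\<forall>x\<in>X. \<exists>y. a * y = b * x \<and> T (ket x) = ket y) \<and> (\<forall>x. x \<notin> X \<longrightarrow> T (ket x) = 0)"

lemma partial_translation_V_op:
  assumes "cancellative TYPE('p::monoid_mult)"
  shows "partial_translation UNIV 1 p (V_op (p::'p))"
  using V_op[OF assms] by (auto simp: partial_translation_def intro: constructible.UNIV)

lemma adj_V_op_ket:
  assumes "cancellative TYPE('p::monoid_mult)"
  shows "adj (V_op p) (ket (p * x)) = ket (x::'p)"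
    and "y \<notin> range ((*) p) \<Longrightarrow> adj (V_op p) (ket y) = 0"
  by (rule ell2_eqI, auto simp: Rep_adj_ket V_op[OF assms] ket.rep_eq zero_ell2.rep_eq
      left_cancel[OF assms])+

lemma partial_translation_adj_V_op:
  assumes "cancellative TYPE('p::monoid_mult)"
  shows "partial_translation (range ((*) p)) p 1 (adj (V_op (p::'p)))"
  using adj_V_op_ket[OF assms] constructible.translate[OF constructible.UNIV, of p]
    clinear_op_adj[OF V_op(1)[OF assms]]
  by (auto simp: partial_translation_def)

text \<open>If \<open>c b' = d a\<close>, then \<open>(a'\<^sup>-\<^sup>1 b') (a\<^sup>-\<^sup>1 b) = (c a')\<^sup>-\<^sup>1 (d b)\<close>. The new domain consists of the
  \<open>x \<in> X\<close> whose image \<open>a\<^sup>-\<^sup>1 b x\<close> lies in \<open>X'\<close>, that is \<open>b x \<in> a X'\<close>; this is where closure of the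
  constructible ideals under translates, preimages and intersections enters.\<close>

lemma partial_translation_compose:
  assumes ore: "left_Ore TYPE('p::monoid_mult)"
    and S: "partial_translation X a b S" and T: "partial_translation X' a' b' T"
  obtains Y c d where "partial_translation Y c d (T o\<^sub>L (S :: 'p ell2 \<Rightarrow>\<^sub>L 'p ell2))"
proof -
  note lc = left_cancel[OF left_Ore_cancellative[OF ore]]
  obtain c d where cd: "c * b' = d * a" using common_left_multiple[OF ore] .
  define Y where "Y = X \<inter> {q. b * q \<in> (*) a ` X'}"
  have "Y \<in> constructible"
    using S T unfolding Y_def partial_translation_def
    by (blast intro: constructible.inter constructible.pullback constructible.translate)
  moreover have "clinear_op (T o\<^sub>L S)"
    using S T by (simp add: partial_translation_def clinear_op_compose)
  moreover have "\<exists>z. c * a' * z = d * b * x \<and> (T o\<^sub>L S) (ket x) = ket z" if x: "x \<in> Y" for x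
  proof -
    obtain y where y: "a * y = b * x" "S (ket x) = ket y"
      using S x unfolding partial_translation_def Y_def by blast
    have "y \<in> X'" using x lc by (auto simp: Y_def y(1)[symmetric])
    then obtain z where z: "a' * z = b' * y" "T (ket y) = ket z"
      using T unfolding partial_translation_def by blast
    have "c * a' * z = (c * b') * y" by (simp add: mult.assoc z(1))
    also have "\<dots> = d * b * x" unfolding cd by (simp add: mult.assoc y(1))
    finally show ?thesis using y z by auto
  qed
  moreover have "(T o\<^sub>L S) (ket x) = 0" if x: "x \<notin> Y" for x
  proof (cases "x \<in> X")
    case True
    then obtain y where y: "a * y = b * x" "S (ket x) = ket y"
      using S unfolding partial_translation_def by blast
    have "y \<notin> X'" using x True by (auto simp: Y_def y(1)[symmetric])
    then show ?thesis using T y by (simp add: partial_translation_def)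
  next
    case False
    then show ?thesis using S by (simp add: partial_translation_def)
  qed
  ultimately have "partial_translation Y (c * a') (d * b) (T o\<^sub>L S)"
    by (simp add: partial_translation_def)
  then show thesis by (rule that)
qed

inductive_set monomials :: "('p::monoid_mult ell2 \<Rightarrow>\<^sub>L 'p ell2) set" where
  isometry: "V_op p \<in> monomials"
| coisometry: "adj (V_op p) \<in> monomials"
| compose: "S \<in> monomials \<Longrightarrow> T \<in> monomials \<Longrightarrow> S o\<^sub>L T \<in> monomials"

lemma monomial_partial_translation:
  assumes "left_Ore TYPE('p::monoid_mult)" "(m :: 'p ell2 \<Rightarrow>\<^sub>L 'p ell2) \<in> monomials"
  shows "\<exists>X a b. partial_translation X a b m"
  using assms(2)
proof induction
  case (compose S T)
  then show ?case using partial_translation_compose[OF assms(1)] by metis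
qed (use partial_translation_V_op partial_translation_adj_V_op left_Ore_cancellative[OF assms(1)]
      in blast)+

lemma monomial_clinear:
  assumes "cancellative TYPE('p::monoid_mult)" "(m :: 'p ell2 \<Rightarrow>\<^sub>L 'p ell2) \<in> monomials"
  shows "clinear_op m"
  using assms(2)
  by induction (simp_all add: V_op[OF assms(1)] clinear_op_adj clinear_op_compose)

lemma monomial_adj:
  assumes "cancellative TYPE('p::monoid_mult)" "(m :: 'p ell2 \<Rightarrow>\<^sub>L 'p ell2) \<in> monomials"
  shows "adj m \<in> monomials"
  using assms(2)
proof induction
  case (compose S T)
  then show ?case
    using assms(1) by (simp add: adj_compose monomial_clinear monomials.compose)
qed (simp_all add: V_op(1)[OF assms(1)] adj_adj monomials.intros)


section \<open>Points realising prescribed intersections of constructible ideals\<close>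

text \<open>Independence says that the intersection \<open>A\<close> of the ideals of \<open>\<X>\<close> that contain \<open>S\<close> is not covered by
  the ideals of \<open>\<X>\<close> that do not: otherwise one of the latter would contain \<open>A \<supseteq> S\<close>. Any uncovered
  point of \<open>A\<close> will do. For \<open>S = {w, v}\<close> a single point of the monoid thus imitates a pair of points,
  which is how the diagonal representation on pairs is compared with the regular one.\<close>

lemma independent_separation:
  fixes \<X> :: "'p::monoid_mult set set"
  assumes indep: "constructible_independent TYPE('p)"
    and \<X>: "finite \<X>" "\<X> \<subseteq> constructible" and S: "S \<noteq> {}"
  obtains t where "\<And>Y. Y \<in> \<X> \<Longrightarrow> t \<in> Y \<longleftrightarrow> S \<subseteq> Y"
proof -
  define A where "A = \<Inter> {Y \<in> \<X>. S \<subseteq> Y}"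
  define \<B> where "\<B> = (\<lambda>Y. A \<inter> Y) ` {Y \<in> \<X>. \<not> S \<subseteq> Y}"
  have "\<Inter> \<Y> \<in> constructible" if "finite \<Y>" "\<Y> \<subseteq> constructible" for \<Y> :: "'p set set"
    using that by induction (simp_all add: constructible.UNIV constructible.inter)
  then have A: "A \<in> constructible" using \<X> unfolding A_def by (metis (no_types, lifting)
      finite_subset mem_Collect_eq subset_iff)
  have SA: "S \<subseteq> A" by (auto simp: A_def)
  have "\<Union> \<B> \<noteq> A"
  proof
    assume eq: "\<Union> \<B> = A"
    then have "\<B> \<noteq> {}" using S SA by auto
    moreover have "finite \<B>" using \<X>(1) by (simp add: \<B>_def)
    moreover have "\<B> \<subseteq> constructible" using \<X>(2) A by (auto simp: \<B>_def intro: constructible.inter)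
    ultimately have "A \<in> \<B>" using indep A eq unfolding constructible_independent_def by blast
    then show False using SA by (auto simp: \<B>_def)
  qed
  moreover have "\<Union> \<B> \<subseteq> A" by (auto simp: \<B>_def)
  ultimately obtain t where "t \<in> A" "t \<notin> \<Union> \<B>" by blast
  then have "t \<in> Y \<longleftrightarrow> S \<subseteq> Y" if "Y \<in> \<X>" for Y using that by (auto simp: A_def \<B>_def)
  then show thesis by (rule that)
qed


section \<open>Orbits of the diagonal translation action\<close>

text \<open>Two pairs are in one orbit when they differ by a left fraction \<open>p\<^sup>-\<^sup>1 q\<close> acting diagonally; in the
  enveloping group the invariant of an orbit is \<open>x\<^sup>-\<^sup>1 y\<close>.\<close>

definition same_orbit :: "'p::monoid_mult \<times> 'p \<Rightarrow> 'p \<times> 'p \<Rightarrow> bool" where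
  "same_orbit z w \<longleftrightarrow> (\<exists>p q. p * fst z = q * fst w \<and> p * snd z = q * snd w)"

lemma same_orbit_refl: "same_orbit z z"
  unfolding same_orbit_def by blast

lemma same_orbit_sym: "same_orbit z w \<Longrightarrow> same_orbit w z"
  unfolding same_orbit_def by metis

lemma same_orbit_trans:
  assumes "left_Ore TYPE('p::monoid_mult)" "same_orbit (u :: 'p \<times> 'p) z" "same_orbit z w"
  shows "same_orbit u w"
proof -
  obtain p q where pq: "p * fst u = q * fst z" "p * snd u = q * snd z"
    using assms(2) unfolding same_orbit_def by blast
  obtain p' q' where pq': "p' * fst z = q' * fst w" "p' * snd z = q' * snd w"
    using assms(3) unfolding same_orbit_def by blast
  obtain c d where "c * q = d * p'" using common_left_multiple[OF assms(1)] .
  then have "c * p * fst u = d * q' * fst w" "c * p * snd u = d * q' * snd w"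
    using pq pq' by (metis mult.assoc)+
  then show ?thesis unfolding same_orbit_def by blast
qed

lemma orbit_common_multiple:
  assumes "left_Ore TYPE('p::monoid_mult)" "finite F"
    and "\<And>z. z \<in> F \<Longrightarrow> same_orbit (z :: 'p \<times> 'p) z0"
  shows "\<exists>r. \<forall>z\<in>F. \<exists>p. p * fst z = r * fst z0 \<and> p * snd z = r * snd z0"
  using assms(2,3)
proof (induction F)
  case (insert z F)
  then obtain r where r: "\<forall>z\<in>F. \<exists>p. p * fst z = r * fst z0 \<and> p * snd z = r * snd z0" by auto
  obtain p q where pq: "p * fst z = q * fst z0" "p * snd z = q * snd z0"
    using insert.prems unfolding same_orbit_def by blast
  obtain c d where cd: "c * r = d * q" using common_left_multiple[OF assms(1)] .
  have "\<exists>p. p * fst u = (c * r) * fst z0 \<and> p * snd u = (c * r) * snd z0" if "u \<in> insert z F" for u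
  proof (cases "u = z")
    case True
    have "d * p * fst u = (c * r) * fst z0" "d * p * snd u = (c * r) * snd z0"
      unfolding cd True using pq by (simp_all add: mult.assoc)
    then show ?thesis by blast
  next
    case False
    then obtain p where "p * fst u = r * fst z0" "p * snd u = r * snd z0" using r \<open>u \<in> insert z F\<close> by blast
    then have "c * p * fst u = (c * r) * fst z0" "c * p * snd u = (c * r) * snd z0"
      by (simp_all add: mult.assoc)
    then show ?thesis by blast
  qed
  then show ?case by blast
qed simp

lemma tensor_vec_zero: "f \<otimes>\<^sub>v 0 = 0" "0 \<otimes>\<^sub>v f = 0"
  by (rule ell2_eqI, simp add: tensor_vec.rep_eq zero_ell2.rep_eq case_prod_unfold)+

text \<open>The partial isometry that undoes an injective relabelling of finitely many basis vectors.\<close>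

lemma partial_pullback:
  fixes \<theta> :: "'b \<Rightarrow> 'a"
  assumes F: "finite F" and inj: "inj_on \<theta> F"
  obtains V :: "'a ell2 \<Rightarrow>\<^sub>L 'b ell2"
  where "clinear_op V" "norm V \<le> 1" "\<And>z. z \<in> F \<Longrightarrow> V (ket (\<theta> z)) = ket z"
proof -
  define V where "V f = (\<Sum>z\<in>F. Rep_ell2 f (\<theta> z) *\<^sub>C ket z)" for f
  have rep: "Rep_ell2 (V f) z = (if z \<in> F then Rep_ell2 f (\<theta> z) else 0)" for f z
    using F by (simp add: V_def Rep_ell2_sum Rep_scaleC_ket)
  have nrm: "norm (V f) \<le> norm f" for f
  proof (rule power2_le_imp_le)
    have "(norm (V f))\<^sup>2 = (\<Sum>x\<in>\<theta> ` F. (cmod (Rep_ell2 f x))\<^sup>2)"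
      unfolding V_def norm_ket_combination[OF F] by (simp add: sum.reindex[OF inj])
    also have "\<dots> \<le> (norm f)\<^sup>2" using F by (intro sum_coord_le_norm) simp
    finally show "(norm (V f))\<^sup>2 \<le> (norm f)\<^sup>2" .
  qed simp
  have bl: "bounded_linear V"
    by (rule bounded_linear_intro[of _ 1])
       (auto intro!: ell2_eqI simp: rep plus_ell2.rep_eq scaleR_ell2.rep_eq nrm)
  have app: "blinfun_apply (Blinfun V) = V" by (rule bounded_linear_Blinfun_apply[OF bl])
  have "clinear_op (Blinfun V)"
    unfolding clinear_op_def app by (auto intro!: ell2_eqI simp: rep scaleC.rep_eq)
  moreover have "norm (Blinfun V) \<le> 1"
    by (rule norm_blinfun_bound) (simp_all add: app nrm)
  moreover have "Blinfun V (ket (\<theta> z)) = ket z" if "z \<in> F" for z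
    unfolding app using inj that by (intro ell2_eqI) (auto simp: rep ket.rep_eq dest: inj_onD)
  ultimately show thesis by (rule that)
qed

text \<open>The heart of the proof. A finite part \<open>F'\<close> of an orbit has a common left multiple \<open>(w, v) = p\<^sub>z z\<close>.
  Choose \<open>t\<close> that lies in each of the finitely many ideals \<open>p\<^sub>z X\<^sub>m\<close> and \<open>p\<^sub>z P\<close> exactly when both \<open>w\<close>
  and \<open>v\<close> do, and define \<open>\<theta> z\<close> by \<open>p\<^sub>z \<theta>(z) = t\<close>. By cancellation \<open>\<theta>(z) \<in> X\<^sub>m\<close> iff both coordinates of \<open>z\<close>
  are in \<open>X\<^sub>m\<close>, and \<open>\<theta>\<close> commutes with left fractions. So on \<open>F\<close> the monomials \<open>m \<otimes> m\<close> look exactly like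
  \<open>m\<close> on \<open>\<theta>(F)\<close>.\<close>

lemma local_intertwiner:
  fixes F :: "('p::monoid_mult \<times> 'p) set" and N :: "('p ell2 \<Rightarrow>\<^sub>L 'p ell2) set"
  assumes ore: "left_Ore TYPE('p)" and indep: "constructible_independent TYPE('p)"
    and N: "finite N" "N \<subseteq> monomials"
    and F: "finite F" "\<And>z. z \<in> F \<Longrightarrow> same_orbit z z0"
  obtains \<theta> :: "'p \<times> 'p \<Rightarrow> 'p" and V :: "'p ell2 \<Rightarrow>\<^sub>L ('p \<times> 'p) ell2"
  where "inj_on \<theta> F" "clinear_op V" "norm V \<le> 1"
    "\<And>m z. m \<in> N \<Longrightarrow> z \<in> F \<Longrightarrow> V (m (ket (\<theta> z))) = (m \<otimes>\<^sub>o m) (ket z)"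
proof -
  note canc = left_Ore_cancellative[OF ore]
  note lc = left_cancel[OF canc] and rc = right_cancel[OF canc]
  have "\<forall>m\<in>N. \<exists>X a b. partial_translation X a b m"
    using monomial_partial_translation[OF ore] N(2) by blast
  then obtain X a b where pt: "\<And>m. m \<in> N \<Longrightarrow> partial_translation (X m) (a m) (b m) m"
    by metis
  then have "\<forall>m\<in>N. \<forall>x\<in>X m. \<exists>y. a m * y = b m * x \<and> m (ket x) = ket y"
    unfolding partial_translation_def by blast
  then obtain s where s: "\<And>m x. m \<in> N \<Longrightarrow> x \<in> X m \<Longrightarrow> a m * s m x = b m * x"
    "\<And>m x. m \<in> N \<Longrightarrow> x \<in> X m \<Longrightarrow> m (ket x) = ket (s m x)" by metis
  have off: "m (ket x) = 0" if "m \<in> N" "x \<notin> X m" for m x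
    using pt[OF that(1)] that(2) by (simp add: partial_translation_def)
  have cl: "clinear_op m" if "m \<in> N" for m
    using pt[OF that] by (simp add: partial_translation_def)
  \<comment> \<open>\<open>F\<close> is enlarged by all images under the monomials of \<open>N\<close>, because \<open>V\<close> must invert \<open>\<theta>\<close> there as well.\<close>
  define F' where "F' = F \<union> {(s m (fst z), s m (snd z)) | m z.
    m \<in> N \<and> z \<in> F \<and> fst z \<in> X m \<and> snd z \<in> X m}"
  have "F' \<subseteq> F \<union> (\<lambda>(m, z). (s m (fst z), s m (snd z))) ` (N \<times> F)"
    by (force simp: F'_def)
  then have finF': "finite F'" using N F by (meson finite_SigmaI finite_UnI finite_imageI finite_subset)
  have "same_orbit u z0" if "u \<in> F'" for u
    using that unfolding F'_def
  proof
    assume "u \<in> {(s m (fst z), s m (snd z)) | m z. m \<in> N \<and> z \<in> F \<and> fst z \<in> X m \<and> snd z \<in> X m}"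
    then obtain m z where mz: "m \<in> N" "z \<in> F" "fst z \<in> X m" "snd z \<in> X m"
      "u = (s m (fst z), s m (snd z))" by blast
    then have "same_orbit u z" unfolding same_orbit_def using s by auto
    then show ?thesis using same_orbit_trans[OF ore] F(2)[OF mz(2)] by blast
  qed (rule F)
  from orbit_common_multiple[OF ore finF' this]
  obtain r where "\<forall>z\<in>F'. \<exists>p. p * fst z = r * fst z0 \<and> p * snd z = r * snd z0" by blast
  then obtain p w v where p: "\<And>z. z \<in> F' \<Longrightarrow> p z * fst z = w" "\<And>z. z \<in> F' \<Longrightarrow> p z * snd z = v"
    by metis
  define \<X> where "\<X> = (\<lambda>(z, m). (*) (p z) ` X m) ` (F \<times> N) \<union> (\<lambda>z. range ((*) (p z))) ` F'"
  have "finite \<X>" using F N finF' by (simp add: \<X>_def)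
  moreover have "\<X> \<subseteq> constructible"
    using pt by (auto simp: \<X>_def partial_translation_def intro: constructible.intros)
  ultimately obtain t where t: "\<And>Y. Y \<in> \<X> \<Longrightarrow> t \<in> Y \<longleftrightarrow> {w, v} \<subseteq> Y"
    using independent_separation[OF indep, of \<X> "{w, v}"] by blast
  have "t \<in> range ((*) (p z))" if z: "z \<in> F'" for z
  proof -
    have "range ((*) (p z)) \<in> \<X>" using z by (auto simp: \<X>_def)
    moreover have "{w, v} \<subseteq> range ((*) (p z))" using p[OF z] by auto
    ultimately show ?thesis using t by blast
  qed
  then have "\<forall>z\<in>F'. \<exists>y. p z * y = t" by (metis imageE)
  then obtain \<theta> where \<theta>: "\<And>z. z \<in> F' \<Longrightarrow> p z * \<theta> z = t" by metis
  have inj: "inj_on \<theta> F'"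
  proof (rule inj_onI)
    fix z z' assume z: "z \<in> F'" "z' \<in> F'" "\<theta> z = \<theta> z'"
    then have "p z = p z'" using \<theta> rc by metis
    then show "z = z'" using p z lc by (metis prod_eqI)
  qed
  obtain V :: "'p ell2 \<Rightarrow>\<^sub>L ('p \<times> 'p) ell2" where V: "clinear_op V" "norm V \<le> 1"
    "\<And>z. z \<in> F' \<Longrightarrow> V (ket (\<theta> z)) = ket z"
    using partial_pullback[OF finF' inj] by blast
  have FF': "F \<subseteq> F'" by (auto simp: F'_def)
  have intertwine: "V (m (ket (\<theta> z))) = (m \<otimes>\<^sub>o m) (ket z)" if m: "m \<in> N" and z: "z \<in> F" for m z
  proof -
    have zF': "z \<in> F'" using z FF' by blast
    have tensor: "(m \<otimes>\<^sub>o m) (ket z) = m (ket (fst z)) \<otimes>\<^sub>v m (ket (snd z))"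
      using tensor_op_ket[OF cl[OF m] cl[OF m], of "fst z" "snd z"] by simp
    have "(*) (p z) ` X m \<in> \<X>" using m z by (force simp: \<X>_def)
    from t[OF this] have "p z * \<theta> z \<in> (*) (p z) ` X m \<longleftrightarrow>
        p z * fst z \<in> (*) (p z) ` X m \<and> p z * snd z \<in> (*) (p z) ` X m"
      by (simp add: \<theta>[OF zF'] p[OF zF'])
    moreover have "p z * x \<in> (*) (p z) ` X m \<longleftrightarrow> x \<in> X m" for x by (auto simp: lc)
    ultimately have dom: "\<theta> z \<in> X m \<longleftrightarrow> fst z \<in> X m \<and> snd z \<in> X m" by simp
    show ?thesis
    proof (cases "\<theta> z \<in> X m")
      case False
      then show ?thesis
        using dom off[OF m] by (auto simp: tensor tensor_vec_zero)
    next
      case True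
      define u where "u = (s m (fst z), s m (snd z))"
      have u: "u \<in> F'" using True dom m z by (auto simp: F'_def u_def)
      obtain c d where cd: "c * p u = d * a m" using common_left_multiple[OF ore] .
      \<comment> \<open>The fraction \<open>p\<^sub>u\<^sup>-\<^sup>1 p\<^sub>z\<close> is that of \<open>m\<close>, as both carry \<open>fst z\<close> to \<open>fst u\<close>; it carries \<open>\<theta> z\<close> to \<open>\<theta> u\<close>.\<close>
      have "c * p z * fst z = c * p u * fst u" using p[OF u] p[OF zF'] by (simp add: mult.assoc)
      also have "\<dots> = d * b m * fst z"
        unfolding cd using s(1)[OF m] True dom by (simp add: u_def mult.assoc)
      finally have cpz: "c * p z = d * b m" by (simp add: rc)
      have "c * p u * s m (\<theta> z) = d * b m * \<theta> z"
        unfolding cd using s(1)[OF m True] by (simp add: mult.assoc)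
      also have "\<dots> = c * p u * \<theta> u"
        unfolding cpz[symmetric] using \<theta>[OF u] \<theta>[OF zF'] by (simp add: mult.assoc)
      finally have "s m (\<theta> z) = \<theta> u" by (simp add: lc)
      then show ?thesis
        using s(2)[OF m] True dom V(3)[OF u] by (simp add: tensor tensor_vec_ket u_def)
    qed
  qed
  show thesis
    by (rule that[OF inj_on_subset[OF inj FF'] V(1,2) intertwine])
qed


section \<open>The norm estimate\<close>

text \<open>The graph of \<open>\<Sum>\<^sub>k c\<^sub>k m\<^sub>k \<mapsto> \<Sum>\<^sub>k c\<^sub>k m\<^sub>k \<otimes> m\<^sub>k\<close>. Working with the relation avoids having to know beforehand
  that the second sum depends only on the first; that follows from the norm estimate.\<close>

inductive_set diagonal_pairs ::
  "(('p::monoid_mult ell2 \<Rightarrow>\<^sub>L 'p ell2) \<times> (('p \<times> 'p) ell2 \<Rightarrow>\<^sub>L ('p \<times> 'p) ell2)) set" where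
  monomial: "m \<in> monomials \<Longrightarrow> (m, m \<otimes>\<^sub>o m) \<in> diagonal_pairs"
| add: "(S, S') \<in> diagonal_pairs \<Longrightarrow> (T, T') \<in> diagonal_pairs \<Longrightarrow> (S + T, S' + T') \<in> diagonal_pairs"
| scale: "(T, T') \<in> diagonal_pairs \<Longrightarrow> (scale_op c T, scale_op c T') \<in> diagonal_pairs"

lemma diagonal_pairs_clinear:
  assumes "cancellative TYPE('p::monoid_mult)"
    and "(T :: 'p ell2 \<Rightarrow>\<^sub>L 'p ell2, T') \<in> diagonal_pairs"
  shows "clinear_op T \<and> clinear_op T'"
  using assms(2)
  by induction (simp_all add: monomial_clinear[OF assms(1)] tensor_op clinear_op_add clinear_op_scale)

text \<open>Compatibility with a linear map \<open>V\<close>, asked at single vectors only: for \<open>T\<close> it reduces to the finitely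
  many monomials \<open>N\<close> occurring in \<open>T\<close>. The vector \<open>g\<close> plays the part of \<open>V f\<close>.\<close>

definition intertwined ::
  "('p::monoid_mult ell2 \<Rightarrow>\<^sub>L 'p ell2) set \<Rightarrow> ('p ell2 \<Rightarrow>\<^sub>L 'p ell2) \<Rightarrow>
    (('p \<times> 'p) ell2 \<Rightarrow>\<^sub>L ('p \<times> 'p) ell2) \<Rightarrow> bool" where
  "intertwined N T T' \<longleftrightarrow> (\<forall>V f g. clinear_op V \<longrightarrow>
     (\<forall>m\<in>N. blinfun_apply V (blinfun_apply m f) = (m \<otimes>\<^sub>o m) g) \<longrightarrow> V (T f) = T' g)"

lemma diagonal_pairs_intertwined:
  fixes T :: "'p::monoid_mult ell2 \<Rightarrow>\<^sub>L 'p ell2"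
  assumes "(T, T') \<in> diagonal_pairs"
  shows "\<exists>N. finite N \<and> N \<subseteq> monomials \<and> intertwined N T T'"
  using assms
proof induction
  case (monomial m)
  then have "finite {m} \<and> {m} \<subseteq> monomials \<and> intertwined {m} m (m \<otimes>\<^sub>o m)"
    by (simp add: intertwined_def)
  then show ?case by blast
next
  case (add S S' T T')
  then obtain N M where N: "finite N" "N \<subseteq> monomials" "intertwined N S S'"
    and M: "finite M" "M \<subseteq> monomials" "intertwined M T T'" by blast
  have "intertwined (N \<union> M) (S + T) (S' + T')"
    unfolding intertwined_def
  proof (intro allI impI)
    fix V f g
    assume V: "clinear_op V" "\<forall>m\<in>N \<union> M. blinfun_apply V (blinfun_apply m f) = (m \<otimes>\<^sub>o m) g"
    then have "V (S f) = S' g" "V (T f) = T' g"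
      using N(3) M(3) unfolding intertwined_def by blast+
    then show "V ((S + T) f) = (S' + T') g" by (simp add: blinfun.add_left blinfun.add_right)
  qed
  with N M show ?case by (meson finite_UnI Un_least)
next
  case (scale T T' c)
  then obtain N where N: "finite N" "N \<subseteq> monomials" "intertwined N T T'" by blast
  have "intertwined N (scale_op c T) (scale_op c T')"
    unfolding intertwined_def
  proof (intro allI impI)
    fix V f g
    assume V: "clinear_op V" "\<forall>m\<in>N. blinfun_apply V (blinfun_apply m f) = (m \<otimes>\<^sub>o m) g"
    then have "V (T f) = T' g" using N(3) unfolding intertwined_def by blast
    then show "V (scale_op c T f) = scale_op c T' g"
      using V(1) by (simp add: scale_op_apply clinear_op_def)
  qed
  with N show ?case by blast
qed

text \<open>With \<open>\<theta>\<close> and \<open>V\<close> as in the local intertwiner and \<open>\<eta>\<close> the relabelling of \<open>\<xi>\<close> along \<open>\<theta>\<close>, one has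
  \<open>T' \<xi> = V (T \<eta>)\<close>, where \<open>V\<close> is contractive and \<open>\<parallel>\<eta>\<parallel> = \<parallel>\<xi>\<parallel>\<close>.\<close>

lemma norm_orbit_vector_le:
  fixes T :: "'p::monoid_mult ell2 \<Rightarrow>\<^sub>L 'p ell2"
  assumes ore: "left_Ore TYPE('p)" and indep: "constructible_independent TYPE('p)"
    and T: "(T, T') \<in> diagonal_pairs"
    and F: "finite F" "\<And>z. z \<in> F \<Longrightarrow> same_orbit z z0"
  shows "norm (T' (\<Sum>z\<in>F. c z *\<^sub>C ket z)) \<le> norm T * norm (\<Sum>z\<in>F. c z *\<^sub>C ket z)"
proof -
  note cl = diagonal_pairs_clinear[OF left_Ore_cancellative[OF ore] T]
  obtain N where N: "finite N" "N \<subseteq> monomials" "intertwined N T T'"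
    using diagonal_pairs_intertwined[OF T] by blast
  obtain \<theta> :: "'p \<times> 'p \<Rightarrow> 'p" and V :: "'p ell2 \<Rightarrow>\<^sub>L ('p \<times> 'p) ell2"
    where inj: "inj_on \<theta> F" and V: "clinear_op V" "norm V \<le> 1"
    "\<And>m z. m \<in> N \<Longrightarrow> z \<in> F \<Longrightarrow> V (m (ket (\<theta> z))) = (m \<otimes>\<^sub>o m) (ket z)"
    using local_intertwiner[OF ore indep N(1,2) F] by metis
  define \<xi> where "\<xi> = (\<Sum>z\<in>F. c z *\<^sub>C ket z)"
  define \<eta> where "\<eta> = (\<Sum>z\<in>F. c z *\<^sub>C ket (\<theta> z))"
  have "V (T (ket (\<theta> z))) = T' (ket z)" if "z \<in> F" for z
    using N(3) V(1) V(3)[OF _ that] unfolding intertwined_def by blast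
  then have T'\<xi>: "T' \<xi> = V (T \<eta>)"
    using cl V(1) by (simp add: \<xi>_def \<eta>_def blinfun.sum_right clinear_op_def)
  have "\<eta> = (\<Sum>x\<in>\<theta> ` F. c (the_inv_into F \<theta> x) *\<^sub>C ket x)"
    by (simp add: \<eta>_def sum.reindex[OF inj] the_inv_into_f_f[OF inj])
  then have "(norm \<eta>)\<^sup>2 = (\<Sum>x\<in>\<theta> ` F. (cmod (c (the_inv_into F \<theta> x)))\<^sup>2)"
    using F(1) by (simp only: norm_ket_combination finite_imageI)
  also have "\<dots> = (norm \<xi>)\<^sup>2"
    using F(1) by (simp add: norm_ket_combination \<xi>_def sum.reindex[OF inj] the_inv_into_f_f[OF inj])
  finally have \<eta>: "norm \<eta> = norm \<xi>" by simp
  have "norm (V (T \<eta>)) \<le> norm V * norm (T \<eta>)" by (rule norm_blinfun)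
  also have "\<dots> \<le> 1 * (norm T * norm \<eta>)" by (intro mult_mono V norm_blinfun) simp_all
  finally show ?thesis by (simp add: T'\<xi> \<eta> flip: \<xi>_def)
qed

lemma diagonal_pairs_orbit:
  fixes T :: "'p::monoid_mult ell2 \<Rightarrow>\<^sub>L 'p ell2"
  assumes ore: "left_Ore TYPE('p)" and "(T, T') \<in> diagonal_pairs" "\<not> same_orbit w z"
  shows "Rep_ell2 (T' (ket z)) w = 0"
  using assms(2)
proof induction
  case (monomial m)
  obtain X a b where pt: "partial_translation X a b m"
    using monomial_partial_translation[OF ore monomial] by blast
  then have cl: "clinear_op m" by (simp add: partial_translation_def)
  show ?case
  proof (rule ccontr)
    assume "Rep_ell2 ((m \<otimes>\<^sub>o m) (ket z)) w \<noteq> 0"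
    then have nz: "Rep_ell2 (m (ket (fst z))) (fst w) \<noteq> 0" "Rep_ell2 (m (ket (snd z))) (snd w) \<noteq> 0"
      using tensor_op_ket[OF cl cl, of "fst z" "snd z"] by (auto simp: tensor_vec.rep_eq case_prod_unfold)
    have "a * y = b * x" if "Rep_ell2 (m (ket x)) y \<noteq> 0" for x y
      using pt that unfolding partial_translation_def
      by (cases "x \<in> X") (force simp: ket.rep_eq zero_ell2.rep_eq split: if_splits)+
    from this[OF nz(1)] this[OF nz(2)] have "same_orbit w z" unfolding same_orbit_def by blast
    with assms(3) show False by blast
  qed
qed (simp_all add: blinfun.add_left plus_ell2.rep_eq scale_op_apply scaleC.rep_eq)

text \<open>Orbits span mutually orthogonal subspaces that \<open>T'\<close> preserves, so the estimates on single orbits add up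
  by Pythagoras.\<close>

lemma norm_finite_vector_le:
  fixes T :: "'p::monoid_mult ell2 \<Rightarrow>\<^sub>L 'p ell2"
  assumes ore: "left_Ore TYPE('p)" and indep: "constructible_independent TYPE('p)"
    and T: "(T, T') \<in> diagonal_pairs" and F: "finite F"
  shows "norm (T' (\<Sum>z\<in>F. c z *\<^sub>C ket z)) \<le> norm T * norm (\<Sum>z\<in>F. c z *\<^sub>C ket z)"
proof (rule power2_le_imp_le)
  note cl = diagonal_pairs_clinear[OF left_Ore_cancellative[OF ore] T]
  define Orb where "Orb z = {w. same_orbit w z}" for z :: "'p \<times> 'p"
  have Orb_eq: "Orb z = Orb w" if "u \<in> Orb z" "u \<in> Orb w" for u z w
    using that same_orbit_trans[OF ore] same_orbit_sym unfolding Orb_def by blast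
  have Orb_self: "z \<in> Orb z" for z by (simp add: Orb_def same_orbit_refl)
  define FC where "FC C = {z \<in> F. Orb z = C}" for C
  define \<xi> where "\<xi> C = (\<Sum>z\<in>FC C. c z *\<^sub>C ket z)" for C
  have finFC: "finite (FC C)" for C using F by (simp add: FC_def)
  have split: "(\<Sum>z\<in>F. c z *\<^sub>C ket z) = (\<Sum>C\<in>Orb ` F. \<xi> C)"
    "(\<Sum>z\<in>F. (cmod (c z))\<^sup>2) = (\<Sum>C\<in>Orb ` F. \<Sum>z\<in>FC C. (cmod (c z))\<^sup>2)"
    unfolding \<xi>_def FC_def by (rule sum.image_gen[OF F])+
  have supp: "Rep_ell2 (T' (\<xi> C)) w = 0" if w: "w \<notin> C" for C w
  proof -
    have "T' (\<xi> C) = (\<Sum>z\<in>FC C. c z *\<^sub>C T' (ket z))"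
      using cl by (simp add: \<xi>_def blinfun.sum_right clinear_op_def)
    moreover have "Rep_ell2 (T' (ket z)) w = 0" if "z \<in> FC C" for z
      by (rule diagonal_pairs_orbit[OF ore T]) (use that w in \<open>auto simp: FC_def Orb_def\<close>)
    ultimately show ?thesis by (simp add: Rep_ell2_sum scaleC.rep_eq)
  qed
  have orth: "orthogonal (T' (\<xi> C)) (T' (\<xi> D))" if CD: "C \<in> Orb ` F" "D \<in> Orb ` F" "C \<noteq> D" for C D
  proof -
    have "x \<notin> C \<or> x \<notin> D" for x using CD Orb_eq by blast
    then have "inner (Rep_ell2 (T' (\<xi> C)) x) (Rep_ell2 (T' (\<xi> D)) x) = 0" for x
      using supp[of x C] supp[of x D] by (metis inner_zero_left inner_zero_right)
    then show ?thesis by (simp add: orthogonal_def inner_ell2_def)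
  qed
  have bound: "norm (T' (\<xi> C)) \<le> norm T * norm (\<xi> C)" if "C \<in> Orb ` F" for C
  proof -
    obtain z0 where "C = Orb z0" using \<open>C \<in> Orb ` F\<close> by blast
    then have "same_orbit z z0" if "z \<in> FC C" for z
      using that Orb_self[of z] by (auto simp: FC_def Orb_def)
    then show ?thesis unfolding \<xi>_def by (rule norm_orbit_vector_le[OF ore indep T finFC])
  qed
  have "T' (\<Sum>z\<in>F. c z *\<^sub>C ket z) = (\<Sum>C\<in>Orb ` F. T' (\<xi> C))"
    by (simp add: split(1) blinfun.sum_right)
  then have "(norm (T' (\<Sum>z\<in>F. c z *\<^sub>C ket z)))\<^sup>2 = (\<Sum>C\<in>Orb ` F. (norm (T' (\<xi> C)))\<^sup>2)"
    using F orth by (simp add: norm_sum_Pythagorean pairwise_def)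
  also have "\<dots> \<le> (\<Sum>C\<in>Orb ` F. (norm T)\<^sup>2 * (norm (\<xi> C))\<^sup>2)"
    using bound by (intro sum_mono) (simp add: power_mult_distrib[symmetric] power_mono)
  also have "\<dots> = (norm T)\<^sup>2 * (\<Sum>z\<in>F. (cmod (c z))\<^sup>2)"
    by (simp add: \<xi>_def norm_ket_combination[OF finFC] sum_distrib_left[symmetric]
        split(2))
  also have "\<dots> = (norm T * norm (\<Sum>z\<in>F. c z *\<^sub>C ket z))\<^sup>2"
    by (simp add: power_mult_distrib norm_ket_combination[OF F])
  finally show "(norm (T' (\<Sum>z\<in>F. c z *\<^sub>C ket z)))\<^sup>2
      \<le> (norm T * norm (\<Sum>z\<in>F. c z *\<^sub>C ket z))\<^sup>2" .
qed simp

lemma diagonal_pairs_norm_le: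
  fixes T :: "'p::monoid_mult ell2 \<Rightarrow>\<^sub>L 'p ell2"
  assumes "left_Ore TYPE('p)" "constructible_independent TYPE('p)" "(T, T') \<in> diagonal_pairs"
  shows "norm T' \<le> norm T"
proof (rule norm_blinfun_bound)
  fix f
  let ?D = "{f. norm (T' f) \<le> norm T * norm f}"
  have "closed ?D" by (intro closed_Collect_le continuous_intros)
  moreover have "f \<in> closure ?D"
    unfolding closure_approachable
  proof (intro allI impI)
    fix e :: real assume "e > 0"
    then obtain F where F: "finite F" "norm (f - (\<Sum>z\<in>F. Rep_ell2 f z *\<^sub>C ket z)) < e"
      using ket_approx by blast
    show "\<exists>g\<in>?D. dist g f < e"
    proof (rule bexI)
      show "dist (\<Sum>z\<in>F. Rep_ell2 f z *\<^sub>C ket z) f < e"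
        using F(2) by (simp add: dist_norm norm_minus_commute)
    qed (use norm_finite_vector_le[OF assms F(1)] in simp)
  qed
  ultimately show "norm (T' f) \<le> norm T * norm f" by simp
qed simp

lemma diagonal_pairs_compose:
  fixes S T :: "'p::monoid_mult ell2 \<Rightarrow>\<^sub>L 'p ell2"
  assumes canc: "cancellative TYPE('p)"
    and S: "(S, S') \<in> diagonal_pairs" and T: "(T, T') \<in> diagonal_pairs"
  shows "(S o\<^sub>L T, S' o\<^sub>L T') \<in> diagonal_pairs"
  using S
proof induction
  case (monomial m)
  note cm = monomial_clinear[OF canc monomial]
  show ?case using T
  proof induction
    case (monomial n)
    then show ?case
      using cm monomial_clinear[OF canc monomial] monomials.compose[OF \<open>m \<in> monomials\<close> monomial]
      by (simp add: tensor_op_compose diagonal_pairs.monomial)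
  next
    case (add U U' W W')
    then show ?case by (simp add: bounded_bilinear.add_right[OF bounded_bilinear_blinfun_compose] diagonal_pairs.add)
  next
    case (scale U U' c)
    then show ?case using cm by (simp add: scale_op_compose_right tensor_op diagonal_pairs.scale)
  qed
next
  case (add U U' W W')
  then show ?case by (simp add: bounded_bilinear.add_left[OF bounded_bilinear_blinfun_compose] diagonal_pairs.add)
next
  case (scale U U' c)
  then show ?case by (simp add: scale_op_compose_left diagonal_pairs.scale)
qed

lemma diagonal_pairs_adj:
  fixes T :: "'p::monoid_mult ell2 \<Rightarrow>\<^sub>L 'p ell2"
  assumes canc: "cancellative TYPE('p)" and T: "(T, T') \<in> diagonal_pairs"
  shows "(adj T, adj T') \<in> diagonal_pairs"
  using T
proof induction
  case (monomial m)
  then show ?case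
    using monomial_clinear[OF canc monomial] diagonal_pairs.monomial[OF monomial_adj[OF canc monomial]]
    by (simp add: adj_tensor_op)
next
  case (add S S' T T')
  then show ?case
    using add.hyps[THEN diagonal_pairs_clinear[OF canc]] by (simp add: adj_add diagonal_pairs.add)
next
  case (scale T T' c)
  then show ?case
    using scale.hyps[THEN diagonal_pairs_clinear[OF canc]]
    by (simp add: adj_scale diagonal_pairs.scale)
qed

lemma diagonal_pairs_min_tensor:
  fixes T :: "'p::monoid_mult ell2 \<Rightarrow>\<^sub>L 'p ell2"
  assumes canc: "cancellative TYPE('p)" and T: "(T, T') \<in> diagonal_pairs"
  shows "T' \<in> reduced_cstar TYPE('p) \<otimes>\<^sub>m\<^sub>i\<^sub>n reduced_cstar TYPE('p)"
proof -
  let ?A = "reduced_cstar TYPE('p)"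
  have A: "cstar_subalgebra ?A"
    unfolding reduced_cstar_def by (rule cstar_subalgebra_generated) (use V_op[OF canc] in auto)
  have iso: "V_op p \<in> ?A" for p
    unfolding reduced_cstar_def by (rule subsetD[OF cstar_generated_superset]) simp
  have mon: "m \<in> ?A" if "m \<in> monomials" for m
    using that
  proof induction
    case (isometry p)
    show ?case by (rule iso)
  next
    case (coisometry p)
    show ?case by (rule cstar_subalgebraD(6)[OF A iso])
  next
    case (compose S T)
    show ?case by (rule cstar_subalgebraD(4)[OF A compose.IH])
  qed
  from T have "T' \<in> tensor_sums ?A ?A"
  proof induction
    case (monomial m)
    show ?case by (intro tensor_sums_single mon monomial)
  next
    case (add S S' T T')
    show ?case by (rule tensor_sums_add[OF add.IH])
  next
    case (scale T T' c)
    show ?case by (rule tensor_sums_scale[OF A A scale.IH])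
  qed
  then show ?thesis by (rule subsetD[OF tensor_sums_subset_min_tensor])
qed

theorem lemma7p5:
  assumes "left_Ore TYPE('p::monoid_mult)"
    and "constructible_independent TYPE('p)"
  shows "\<exists>\<Delta>. cstar_hom (reduced_cstar TYPE('p))
             (reduced_cstar TYPE('p) \<otimes>\<^sub>m\<^sub>i\<^sub>n reduced_cstar TYPE('p)) \<Delta> \<and>
           (\<forall>p::'p. \<Delta> (V_op p) = V_op p \<otimes>\<^sub>o V_op p) \<and>
           (\<forall>\<Delta>'. cstar_hom (reduced_cstar TYPE('p))
                   (reduced_cstar TYPE('p) \<otimes>\<^sub>m\<^sub>i\<^sub>n reduced_cstar TYPE('p)) \<Delta>' \<and>
                 (\<forall>p::'p. \<Delta>' (V_op p) = V_op p \<otimes>\<^sub>o V_op p) \<longrightarrow>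
                 (\<forall>T \<in> reduced_cstar TYPE('p). \<Delta>' T = \<Delta> T))"
proof -
  note canc = left_Ore_cancellative[OF assms(1)]
  let ?A = "reduced_cstar TYPE('p)" and ?G = "range (V_op :: 'p \<Rightarrow> _)"
  have G: "clinear_op T" if "T \<in> ?G" for T using that V_op(1)[OF canc] by blast
  have A: "clinear_op T" if "T \<in> ?A" for T
    using that cstar_subalgebraD(1)[OF cstar_subalgebra_generated[of ?G, OF G]]
    by (simp add: reduced_cstar_def)
  have pairs: "(V_op p, V_op p \<otimes>\<^sub>o V_op p) \<in> diagonal_pairs" for p :: 'p
    by (intro diagonal_pairs.monomial monomials.isometry)
  have sup: "?G \<subseteq> fst ` (diagonal_pairs :: (('p ell2 \<Rightarrow>\<^sub>L 'p ell2) \<times> _) set)" using pairs by force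
  have rng: "snd ` diagonal_pairs \<subseteq> ?A \<otimes>\<^sub>m\<^sub>i\<^sub>n ?A"
    using diagonal_pairs_min_tensor[OF canc] by auto
  have "\<exists>\<Delta>. cstar_hom (cstar_generated ?G) (?A \<otimes>\<^sub>m\<^sub>i\<^sub>n ?A) \<Delta> \<and>
      (\<forall>(T, T')\<in>diagonal_pairs. \<Delta> T = T')"
    by (rule cstar_hom_extension[OF diagonal_pairs_clinear[OF canc] diagonal_pairs.add
          diagonal_pairs_compose[OF canc] diagonal_pairs.scale diagonal_pairs_adj[OF canc]
          diagonal_pairs_norm_le[OF assms] _ sup closed_min_tensor rng]) simp_all
  then obtain \<Delta> where hom: "cstar_hom (cstar_generated ?G) (?A \<otimes>\<^sub>m\<^sub>i\<^sub>n ?A) \<Delta>"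
    and "\<forall>(T, T')\<in>diagonal_pairs. \<Delta> T = T'" by (elim exE conjE)
  then have \<Delta>: "\<Delta> (V_op p) = V_op p \<otimes>\<^sub>o V_op p" for p :: 'p
    using pairs[of p] by auto
  have gen: "cstar_generated ?G = ?A" by (simp add: reduced_cstar_def)
  have B: "clinear_op S" if "S \<in> ?A \<otimes>\<^sub>m\<^sub>i\<^sub>n ?A" for S
    using min_tensor_clinear[OF A A that] .
  have unique: "\<Delta>' T = \<Delta> T"
    if \<Delta>': "cstar_hom ?A (?A \<otimes>\<^sub>m\<^sub>i\<^sub>n ?A) \<Delta>'" "\<forall>p::'p. \<Delta>' (V_op p) = V_op p \<otimes>\<^sub>o V_op p"
      and T: "T \<in> ?A" for \<Delta>' T
  proof (rule cstar_hom_eqI[OF G B _ hom])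
    show "cstar_hom (cstar_generated ?G) (?A \<otimes>\<^sub>m\<^sub>i\<^sub>n ?A) \<Delta>'" using \<Delta>'(1) by (simp only: gen)
    show "\<Delta>' S = \<Delta> S" if "S \<in> ?G" for S using that \<Delta>'(2) \<Delta> by auto
    show "T \<in> cstar_generated ?G" using T by (simp only: gen)
  qed
  show ?thesis
    by (intro exI[of _ \<Delta>] conjI allI impI ballI hom[unfolded gen] \<Delta> unique) simp_all
qed

end
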